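(* Consider the convex problem $\min_{x\in\mathbb R^n}\{\rho(x)=f(x)+g(x):\ G(x)\in-\mathcal K\}$ under the standing assumptions given in the context, and let $(x^*,y^* )$ be a primal–dual optimal solution. Let $\{(x_k,y_k)\}_{k\ge0}$ be generated by the modified APDB algorithm (described in the context) applied to $$\min_{x\in\mathbb R^n}\max_{y\in\mathbb R^m}\ f(x)+g(x)+\langle G(x),y\rangle-h(y),\qquad h=\mathbb I_{\mathcal K^*},$$ from $x_0\in\mathrm{dom} f$, $y_0\in\mathcal K^*$, with $\{\alpha_k,\beta_k\}$ chosen as $\alpha_{k+1}=c_\alpha/\tau_k$ and $\beta_{k+1}=\gamma_0c_\beta/\sigma_k$ for $k\ge0$. Assume that either $\mathcal K=\mathbb R^m_+$ or $\nabla G$ is bounded on $\mathrm{dom} f$. Then $$\|y_k\|\le\bar B=\|y^*\|+\sqrt{\gamma_0\|x^*-x_0\|^2+\|y^*-y_0\|^2},\qquad\forall k\ge0.$$ Moreover, put $t_k=\sigma_k/\sigma_0$ (accepted step sizes), $T_K=\sum_{k=0}^{K-1}t_k$, $\bar x_K=\frac1{T_K}\sum_{k=0}^{K-1}t_kx_{k+1}$, and $\Delta(x,y)=\frac1{2\tau_0}\|x-x_0\|^2+\frac1{2\sigma_0}\|y-y_0\|^2$. Then for any $\kappa>0$ and all $K\ge1$, $$\max\Big\{|\rho(\bar x_K)-\rho(x^* )|,\ \kappa\,d_{-\mathcal K}\big(G(\bar x_K)\big)\Big\}\le\frac1{T_K}\Delta(x^*,y_K^\dagger)=\mathcal O(1/T_K),$$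 where $y_K^\dagger=(\|y^*\|+\kappa)\,\mathcal P_{\mathcal K^*}(G(\bar x_K))\,\|\mathcal P_{\mathcal K^*}(G(\bar x_K))\|^{-1}$ (with $y_K^\dagger=0$ if $\mathcal P_{\mathcal K^*}(G(\bar x_K))=0$). Finally, $T_K=\Omega(K)$ for $\mu=0$, and $T_K=\Omega(K^2)$ for $\mu>0$.
   Context: Standing assumptions. $\mathbb R^n$, $\mathbb R^m$ are Euclidean with norm $\|\cdot\|$; Bregman distances are $\mathbf D(x,\bar x)=\frac12\|x-\bar x\|^2$ in both spaces. $f:\mathbb R^n\to\mathbb R\cup\{+\infty\}$ is closed convex (possibly nonsmooth) with convexity modulus $\mu\ge0$; $g:\mathbb R^n\to\mathbb R$ is convex with $L_g$-Lipschitz gradient; $\mathcal K\subset\mathbb R^m$ is a closed convex cone with dual cone $\mathcal K^*=\{y:\langle y,w\rangle\ge0\ \forall w\in\mathcal K\}$; $G:\mathbb R^n\to\mathbb R^m$ is $\mathcal K$-convex (i.e. $\lambda G(x)+(1-\lambda)G(x')-G(\lambda x+(1-\lambda)x')\in\mathcal K$ for $\lambda\in[0,1]$), Lipschitz with constant $C_G>0$, and has Jacobian $\nabla G$ Lipschitz with constant $L_G\ge0$. A primal–dual optimal solution $(x^*,y^* )$ exists, i.e. a saddle point of $\rho(x)+\langle G(x),y\rangle$ over $x\in\mathbb R^n$, $y\in\mathcal K^*$. The set $\mathcal K^*$ may be unbounded, so $\nabla_x\Phi(\cdot,y)$ need not be Lipschitz with a constant uniform in $y\in\mathcal K^*$.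 Notation. $\mathcal P_{C}(w)=\arg\min_{y\in C}\|y-w\|$, $d_{C}(w)=\|\mathcal P_C(w)-w\|$; $\mathbb I_S$ is the indicator function ($0$ on $S$, $+\infty$ off $S$). Modified APDB (with $\Phi(x,y)=g(x)+\langle G(x),y\rangle$). Parameters: $\mu$, $\eta\in(0,1)$, $\bar\tau,\gamma_0>0$, $\delta\in[0,1)$, $c_\alpha,c_\beta>0$ with $c_\alpha+c_\beta+\delta\in(0,1)$. Set $(x_{-1},y_{-1})=(x_0,y_0)$, $\tau_0=\tau_{-1}=\bar\tau$, $\sigma_{-1}=\gamma_0\bar\tau$, $\alpha_0=c_\alpha/\tau_{-1}$, $\beta_0=\gamma_0c_\beta/\sigma_{-1}$. For $k\ge0$: (a) (inner loop) set $\sigma_k=\gamma_k\tau_k$, $\theta_k=\sigma_{k-1}/\sigma_k$, $\alpha_{k+1}=c_\alpha/\tau_k$, $\beta_{k+1}=\gamma_0c_\beta/\sigma_k$ and compute $s_k=(1+\theta_k)\nabla_x\Phi(x_k,y_k)-\theta_k\nabla_x\Phi(x_{k-1},y_{k-1})$, $x_{k+1}=\arg\min_x f(x)+\langle s_k,x\rangle+\frac1{\tau_k}\mathbf D(x,x_k)$, $y_{k+1}=\arg\min_y h(y)-\langle\nabla_y\Phi(x_{k+1},y_k),y\rangle+\frac1{\sigma_k}\mathbf D(y,y_k)$. If $E_k(x_{k+1},y_{k+1})\le-\frac\delta{\tau_k}\mathbf D(x_{k+1},x_k)-\frac\delta{\sigma_k}\mathbf D(y_{k+1},y_k)$, accept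 and go to (b); otherwise replace $\tau_k$ by $\eta\tau_k$ and repeat (a). (b) Set $\gamma_{k+1}=\gamma_k(1+\mu\tau_k)$, $\tau_{k+1}=\tau_k\sqrt{\gamma_k/\gamma_{k+1}}$ (initial trial value for iteration $k+1$). Here $$\begin{aligned}E_k(x,y)=\;&\tfrac1{2\alpha_{k+1}}\|\nabla_x\Phi(x,y)-\nabla_x\Phi(x,y_k)\|^2-\tfrac1{\sigma_k}\mathbf D(y,y_k)\\&+\tfrac1{2\beta_{k+1}}\|\nabla_x\Phi(x,y_k)-\nabla_x\Phi(x_k,y_k)\|^2-\Big(\tfrac1{\tau_k}-\theta_k(\alpha_k+\beta_k)\Big)\mathbf D(x,x_k).\end{aligned}$$ Asymptotic notation is as $K\to\infty$, with constants independent of $K$.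
   Formalization: The printed rate bound fails for κ<‖y*‖. Proved instead for all κ>0: max{ρ(x̄_K)−ρ(x* ), κd} ≤ Δ(x*,y†_K)/T_K, and the bound with |ρ(x̄_K)−ρ(x* )| with right side multiplied by max{1,‖y*‖/κ}, which is the printed bound when κ≥‖y*‖. *)

theory Defs
  imports "HOL-Analysis.Analysis" "HOL-Library.Landau_Symbols"
begin

text \<open>Functions with values in the reals extended by \<open>+\<infinity>\<close> are \<^typ>\<open>ereal\<close>-valued functions that
  never take the value \<open>-\<infinity>\<close>.\<close>

definition edom :: "('a \<Rightarrow> ereal) \<Rightarrow> 'a set" where
  "edom f = {x. f x < \<infinity>}"

definition closed_fun :: "('a::topological_space \<Rightarrow> ereal) \<Rightarrow> bool" where
  "closed_fun f \<longleftrightarrow> closed {(x, r::real). f x \<le> ereal r}"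

text \<open>Convexity with modulus \<open>\<mu>\<close>; \<open>\<mu> = 0\<close> is plain convexity. The endpoints \<open>u = 0\<close>, \<open>u = 1\<close> are
  trivial and left out.\<close>

definition econvex_mod :: "real \<Rightarrow> ('a::real_normed_vector \<Rightarrow> ereal) \<Rightarrow> bool" where
  "econvex_mod \<mu> f \<longleftrightarrow>
     (\<forall>x x' u. 0 < u \<and> u < 1 \<longrightarrow>
        f (u *\<^sub>R x + (1 - u) *\<^sub>R x') + ereal (\<mu> / 2 * u * (1 - u) * (norm (x - x'))\<^sup>2)
          \<le> ereal u * f x + ereal (1 - u) * f x')"

definition ind_fun :: "'a set \<Rightarrow> 'a \<Rightarrow> ereal" where
  "ind_fun S x = (if x \<in> S then 0 else \<infinity>)"

definition dual_cone :: "'a::real_inner set \<Rightarrow> 'a set" where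
  "dual_cone \<K> = {y. \<forall>w\<in>\<K>. 0 \<le> y \<bullet> w}"

definition cone_convex :: "'b::real_vector set \<Rightarrow> ('a::real_vector \<Rightarrow> 'b) \<Rightarrow> bool" where
  "cone_convex \<K> G \<longleftrightarrow>
     (\<forall>x x' u. 0 \<le> u \<and> u \<le> 1 \<longrightarrow>
        u *\<^sub>R G x + (1 - u) *\<^sub>R G x' - G (u *\<^sub>R x + (1 - u) *\<^sub>R x') \<in> \<K>)"

definition proj_dist :: "'a::euclidean_space set \<Rightarrow> 'a \<Rightarrow> real" where
  "proj_dist C w = norm (closest_point C w - w)"

text \<open>Only meaningful at points where \<open>F\<close> is differentiable.\<close>

definition gradient :: "('a::real_inner \<Rightarrow> real) \<Rightarrow> 'a \<Rightarrow> 'a" where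
  "gradient F x = (THE D. GDERIV F x :> D)"

definition saddle_point :: "'a set \<Rightarrow> 'b set \<Rightarrow> ('a \<Rightarrow> 'b \<Rightarrow> ereal) \<Rightarrow> 'a \<Rightarrow> 'b \<Rightarrow> bool" where
  "saddle_point X Y L x y \<longleftrightarrow>
     x \<in> X \<and> y \<in> Y \<and> (\<forall>y'\<in>Y. L x y' \<le> L x y) \<and> (\<forall>x'\<in>X. L x y \<le> L x' y)"

definition breg :: "'a::real_normed_vector \<Rightarrow> 'a \<Rightarrow> real" where
  "breg x x' = (norm (x - x'))\<^sup>2 / 2"


text \<open>The algorithm, for \<open>min\<^sub>x max\<^sub>y f x + \<Phi> x y - h y\<close>. The sequences \<open>x, y, \<tau>, \<gamma>\<close> are indexed from
  \<open>0\<close>, with \<open>\<tau> k\<close> the accepted step size of iteration \<open>k\<close>; \<open>prev a s k\<close> is the entry of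
  index \<open>k - 1\<close> of a sequence whose entry of index \<open>-1\<close> is \<open>a\<close>.\<close>

record apdb_params =
  p_mu :: real
  p_eta :: real
  p_tau :: real
  p_gamma :: real
  p_delta :: real
  p_calpha :: real
  p_cbeta :: real

definition valid_params :: "apdb_params \<Rightarrow> bool" where
  "valid_params p \<longleftrightarrow>
     0 \<le> p_mu p \<and> 0 < p_eta p \<and> p_eta p < 1 \<and> 0 < p_tau p \<and> 0 < p_gamma p \<and>
     0 \<le> p_delta p \<and> p_delta p < 1 \<and> 0 < p_calpha p \<and> 0 < p_cbeta p \<and>
     0 < p_calpha p + p_cbeta p + p_delta p \<and> p_calpha p + p_cbeta p + p_delta p < 1"

definition prev :: "'a \<Rightarrow> (nat \<Rightarrow> 'a) \<Rightarrow> nat \<Rightarrow> 'a" where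
  "prev a s k = (case k of 0 \<Rightarrow> a | Suc j \<Rightarrow> s j)"

definition tau_prev :: "apdb_params \<Rightarrow> (nat \<Rightarrow> real) \<Rightarrow> nat \<Rightarrow> real" where
  "tau_prev p \<tau> k = prev (p_tau p) \<tau> k"

definition sigma_prev :: "apdb_params \<Rightarrow> (nat \<Rightarrow> real) \<Rightarrow> (nat \<Rightarrow> real) \<Rightarrow> nat \<Rightarrow> real" where
  "sigma_prev p \<tau> \<gamma> k = prev (p_gamma p * p_tau p) (\<lambda>j. \<gamma> j * \<tau> j) k"

definition tau_trial :: "apdb_params \<Rightarrow> (nat \<Rightarrow> real) \<Rightarrow> (nat \<Rightarrow> real) \<Rightarrow> nat \<Rightarrow> real" where
  "tau_trial p \<tau> \<gamma> k = prev (p_tau p) (\<lambda>j. \<tau> j * sqrt (\<gamma> j / \<gamma> (Suc j))) k"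

text \<open>The trial pair \<open>(x', y')\<close> computed in iteration \<open>k\<close> with the trial step size \<open>t\<close>.\<close>

definition apdb_trial ::
  "apdb_params \<Rightarrow> ('a::euclidean_space \<Rightarrow> ereal) \<Rightarrow> ('b::euclidean_space \<Rightarrow> ereal) \<Rightarrow> ('a \<Rightarrow> 'b \<Rightarrow> real) \<Rightarrow>
   (nat \<Rightarrow> 'a) \<Rightarrow> (nat \<Rightarrow> 'b) \<Rightarrow> (nat \<Rightarrow> real) \<Rightarrow> (nat \<Rightarrow> real) \<Rightarrow> nat \<Rightarrow> real \<Rightarrow> 'a \<Rightarrow> 'b \<Rightarrow> bool" where
  "apdb_trial p f h \<Phi> x y \<tau> \<gamma> k t x' y' \<longleftrightarrow>
     (let \<sigma>' = \<gamma> k * t;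
          \<theta> = sigma_prev p \<tau> \<gamma> k / \<sigma>';
          x\<^sub>p = prev (x 0) x k;
          y\<^sub>p = prev (y 0) y k;
          s = (1 + \<theta>) *\<^sub>R gradient (\<lambda>z. \<Phi> z (y k)) (x k)
                - \<theta> *\<^sub>R gradient (\<lambda>z. \<Phi> z y\<^sub>p) x\<^sub>p
      in is_arg_min (\<lambda>z. f z + ereal (s \<bullet> z + 1 / t * breg z (x k))) (\<lambda>_. True) x' \<and>
         is_arg_min (\<lambda>v. h v + ereal (- (gradient (\<lambda>v. \<Phi> x' v) (y k) \<bullet> v) + 1 / \<sigma>' * breg v (y k)))
           (\<lambda>_. True) y')"

definition apdb_E ::
  "apdb_params \<Rightarrow> ('a::euclidean_space \<Rightarrow> 'b::euclidean_space \<Rightarrow> real) \<Rightarrow>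
   (nat \<Rightarrow> 'a) \<Rightarrow> (nat \<Rightarrow> 'b) \<Rightarrow> (nat \<Rightarrow> real) \<Rightarrow> (nat \<Rightarrow> real) \<Rightarrow> nat \<Rightarrow> real \<Rightarrow> 'a \<Rightarrow> 'b \<Rightarrow> real" where
  "apdb_E p \<Phi> x y \<tau> \<gamma> k t x' y' =
     (let \<sigma>' = \<gamma> k * t;
          \<theta> = sigma_prev p \<tau> \<gamma> k / \<sigma>';
          \<alpha> = p_calpha p / tau_prev p \<tau> k;
          \<beta> = p_gamma p * p_cbeta p / sigma_prev p \<tau> \<gamma> k;
          \<alpha>' = p_calpha p / t;
          \<beta>' = p_gamma p * p_cbeta p / \<sigma>'
      in 1 / (2 * \<alpha>') * (norm (gradient (\<lambda>z. \<Phi> z y') x' - gradient (\<lambda>z. \<Phi> z (y k)) x'))\<^sup>2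
         - 1 / \<sigma>' * breg y' (y k)
         + 1 / (2 * \<beta>') * (norm (gradient (\<lambda>z. \<Phi> z (y k)) x' - gradient (\<lambda>z. \<Phi> z (y k)) (x k)))\<^sup>2
         - (1 / t - \<theta> * (\<alpha> + \<beta>)) * breg x' (x k))"

definition apdb_accept ::
  "apdb_params \<Rightarrow> ('a::euclidean_space \<Rightarrow> 'b::euclidean_space \<Rightarrow> real) \<Rightarrow>
   (nat \<Rightarrow> 'a) \<Rightarrow> (nat \<Rightarrow> 'b) \<Rightarrow> (nat \<Rightarrow> real) \<Rightarrow> (nat \<Rightarrow> real) \<Rightarrow> nat \<Rightarrow> real \<Rightarrow> 'a \<Rightarrow> 'b \<Rightarrow> bool" where
  "apdb_accept p \<Phi> x y \<tau> \<gamma> k t x' y' \<longleftrightarrow>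
     apdb_E p \<Phi> x y \<tau> \<gamma> k t x' y'
       \<le> - (p_delta p / t) * breg x' (x k) - (p_delta p / (\<gamma> k * t)) * breg y' (y k)"

text \<open>In iteration \<open>k\<close> the inner loop rejects the first \<open>j\<close> trial step sizes
  and accepts the next one.\<close>

definition apdb_run ::
  "apdb_params \<Rightarrow> ('a::euclidean_space \<Rightarrow> ereal) \<Rightarrow> ('b::euclidean_space \<Rightarrow> ereal) \<Rightarrow> ('a \<Rightarrow> 'b \<Rightarrow> real) \<Rightarrow>
   'a \<Rightarrow> 'b \<Rightarrow> (nat \<Rightarrow> 'a) \<Rightarrow> (nat \<Rightarrow> 'b) \<Rightarrow> (nat \<Rightarrow> real) \<Rightarrow> (nat \<Rightarrow> real) \<Rightarrow> bool" where
  "apdb_run p f h \<Phi> x\<^sub>0 y\<^sub>0 x y \<tau> \<gamma> \<longleftrightarrow>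
     x 0 = x\<^sub>0 \<and> y 0 = y\<^sub>0 \<and> \<gamma> 0 = p_gamma p \<and>
     (\<forall>k. \<gamma> (Suc k) = \<gamma> k * (1 + p_mu p * \<tau> k)) \<and>
     (\<forall>k. \<exists>j. \<tau> k = p_eta p ^ j * tau_trial p \<tau> \<gamma> k \<and>
        (\<forall>i<j. \<exists>x' y'. apdb_trial p f h \<Phi> x y \<tau> \<gamma> k (p_eta p ^ i * tau_trial p \<tau> \<gamma> k) x' y' \<and>
           \<not> apdb_accept p \<Phi> x y \<tau> \<gamma> k (p_eta p ^ i * tau_trial p \<tau> \<gamma> k) x' y') \<and>
        apdb_trial p f h \<Phi> x y \<tau> \<gamma> k (\<tau> k) (x (Suc k)) (y (Suc k)) \<and>
        apdb_accept p \<Phi> x y \<tau> \<gamma> k (\<tau> k) (x (Suc k)) (y (Suc k)))"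

end

theory Submission
  imports Defs
begin

text \<open>
  Write \<open>D\<close> for \<^const>\<open>breg\<close>, \<open>\<Phi> z v = g z + G z \<bullet> v\<close>, and call the quantity
  \<open>f x\<^sub>k\<^sub>+\<^sub>1 + \<Phi> x\<^sub>k\<^sub>+\<^sub>1 v - f z - \<Phi> z y\<^sub>k\<^sub>+\<^sub>1\<close> the gap of iteration \<open>k\<close> at \<open>(z, v)\<close>, for \<open>v\<close> in the dual cone.

  The strong convexity of the two proximal subproblems and the convexity of \<open>\<Phi> \<cdot> y\<^sub>k\<^sub>+\<^sub>1\<close> bound the gap
  by differences of Bregman distances plus an error \<open>\<langle>\<nabla>\<^sub>x\<Phi> x\<^sub>k\<^sub>+\<^sub>1 y\<^sub>k\<^sub>+\<^sub>1 - s\<^sub>k, x\<^sub>k\<^sub>+\<^sub>1 - z\<rangle>\<close>. The extrapolation in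
  \<open>s\<^sub>k\<close> makes this error telescope up to a term that Young's inequality splits into a part controlled
  by the acceptance test of iteration \<open>k\<close> and a part carried over from iteration \<open>k - 1\<close>. After
  multiplication by \<open>\<sigma>\<^sub>k\<close> everything telescopes (\<open>energy_step\<close>): the updates of \<open>\<gamma>\<close> and \<open>\<tau>\<close> are chosen so
  that the weight \<open>\<sigma>\<^sub>k (\<mu> + 1 / \<tau>\<^sub>k)\<close> left behind by one iteration is the weight \<open>\<gamma>\<^sub>k\<^sub>+\<^sub>1\<close> that the next one
  starts from. The energy \<open>V\<close> dominates \<open>D v y\<^sub>k\<close> because \<open>c\<^sub>\<alpha> + c\<^sub>\<beta> < 1\<close> (\<open>breg_le_V\<close>). The gap is
  nonnegative at the saddle point, so the dual iterates stay in a ball around \<open>y\<^sup>*\<close>.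

  For the rate, Jensen's inequality turns the summed energy estimate into
  \<open>\<rho> xbar - \<rho> x\<^sup>* + G xbar \<bullet> v \<le> \<Delta> x\<^sup>* v / T\<close> for every \<open>v\<close> in the dual cone. Moreau's decomposition of
  \<open>G xbar\<close> along the cone and its polar shows that \<open>v = ydag\<close> gives
  \<open>G xbar \<bullet> v = (norm y\<^sup>* + \<kappa>) d\<close>, where \<open>d\<close> is the infeasibility of \<open>xbar\<close>, whereas the saddle point
  inequality gives \<open>\<rho> xbar - \<rho> x\<^sup>* \<ge> - norm y\<^sup>* d\<close>. The surplus \<open>\<kappa> d\<close> is what bounds the infeasibility
  (\<open>ergodic_rate\<close>).

  For the growth of \<open>T\<close>, the bound on the dual iterates makes \<open>\<nabla>\<^sub>x\<Phi>\<close> uniformly Lipschitz along the run.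
  A trial step \<open>s\<close> therefore passes the test as soon as \<open>\<gamma>\<^sub>k s\<^sup>2\<close> is below a constant
  (\<open>short_steps_accepted\<close>). The step size update preserves \<open>\<gamma>\<^sub>k \<tau>\<^sub>k\<^sup>2\<close> and a rejection shrinks it by
  \<open>\<eta>\<^sup>2\<close>, hence \<open>\<gamma>\<^sub>k \<tau>\<^sub>k\<^sup>2\<close> stays bounded below and \<open>\<sigma>\<^sub>k\<close> is at least a multiple of \<open>\<surd>\<gamma>\<^sub>k\<close>. This
  gives linear growth of \<open>T\<close>; if \<open>\<mu> > 0\<close>, then \<open>\<gamma>\<^sub>k\<^sub>+\<^sub>1 - \<gamma>\<^sub>k\<close> is at least a multiple of \<open>\<surd>\<gamma>\<^sub>k\<close>,
  so \<open>\<surd>\<gamma>\<^sub>k\<close> grows linearly and \<open>T\<close> quadratically.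
\<close>

section \<open>Gradients of convex and Lipschitz maps\<close>

lemma gradient_eqI:
  assumes "GDERIV F z :> D"
  shows "gradient F z = D"
  unfolding gradient_def
proof (rule the_equality)
  show "GDERIV F z :> D" by fact
  fix D' assume "GDERIV F z :> D'"
  then have "(\<lambda>h. h \<bullet> D') = (\<lambda>h. h \<bullet> D)"
    using assms by (auto simp: gderiv_def intro: has_derivative_unique)
  then show "D' = D" by (metis vector_eq_ldot)
qed

lemma GDERIV_gradient:
  fixes F :: "'a::euclidean_space \<Rightarrow> real"
  assumes "F differentiable at z"
  shows "GDERIV F z :> gradient F z"
proof -
  obtain F' where F': "(F has_derivative F') (at z)"
    using assms by (auto simp: differentiable_def)
  then have "linear F'" by (rule has_derivative_linear)
  then have "F' = (\<lambda>h. h \<bullet> adjoint F' 1)"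
    by (simp add: adjoint_works)
  with F' have "GDERIV F z :> adjoint F' 1"
    by (simp add: gderiv_def)
  then show ?thesis using gradient_eqI by metis
qed

text \<open>Restriction to the line through \<open>a\<close> and \<open>z\<close> reduces this to the tangent inequality for convex
  functions of a real variable.\<close>

lemma convex_gradient_inequality:
  assumes conv: "convex_on UNIV F" and D: "GDERIV F a :> D"
  shows "F a + D \<bullet> (z - a) \<le> F z"
proof -
  define \<phi> where "\<phi> u = F (a + u *\<^sub>R (z - a))" for u :: real
  have "convex_on UNIV \<phi>"
  proof (rule convex_onI)
    fix u r s :: real assume u: "0 < u" "u < 1"
    have "a + ((1 - u) *\<^sub>R r + u *\<^sub>R s) *\<^sub>R (z - a)
        = (1 - u) *\<^sub>R (a + r *\<^sub>R (z - a)) + u *\<^sub>R (a + s *\<^sub>R (z - a))"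
      by (simp add: algebra_simps)
    then show "\<phi> ((1 - u) *\<^sub>R r + u *\<^sub>R s) \<le> (1 - u) * \<phi> r + u * \<phi> s"
      unfolding \<phi>_def using convex_onD[OF conv, of u] u by auto
  qed auto
  moreover have "(\<phi> has_real_derivative D \<bullet> (z - a)) (at 0)"
  proof -
    have "((\<lambda>u::real. a + u *\<^sub>R (z - a)) has_derivative (\<lambda>u. u *\<^sub>R (z - a))) (at 0)"
      by (auto intro!: derivative_eq_intros)
    moreover have "(F has_derivative (\<lambda>h. h \<bullet> D)) (at (a + 0 *\<^sub>R (z - a)))"
      using D by (simp add: gderiv_def)
    ultimately have "(\<phi> has_derivative (\<lambda>u. (u *\<^sub>R (z - a)) \<bullet> D)) (at 0)"
      unfolding \<phi>_def by (rule has_derivative_compose)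
    moreover have "(\<lambda>u. (u *\<^sub>R (z - a)) \<bullet> D) = (*) (D \<bullet> (z - a))"
      by (auto simp: inner_commute)
    ultimately show ?thesis by (simp add: has_field_derivative_def)
  qed
  ultimately have "\<phi> 1 - \<phi> 0 \<ge> D \<bullet> (z - a) * (1 - 0)"
    by (intro convex_on_imp_above_tangent[where A = UNIV]) auto
  then show ?thesis by (simp add: \<phi>_def)
qed

text \<open>A difference quotient in direction \<open>h\<close> is at most \<open>C * norm h\<close> and approximates \<open>D h\<close>. For the
  constraint map this makes the Jacobian globally bounded.\<close>

lemma lipschitz_derivative_bound:
  assumes lip: "C-lipschitz_on UNIV F" and D: "(F has_derivative D) (at z)"
  shows "norm (D h) \<le> C * norm h"
proof (cases "h = 0")
  case True
  then show ?thesis using has_derivative_linear[OF D] by (simp add: linear_0)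
next
  case False
  show ?thesis
  proof (rule field_le_epsilon)
    fix e :: real assume "0 < e"
    with False have "0 < e / norm h" by simp
    with D obtain d where d: "0 < d"
      and near: "\<And>v. norm (v - z) < d \<Longrightarrow> norm (F v - F z - D (v - z)) \<le> e / norm h * norm (v - z)"
      unfolding has_derivative_at_alt by blast
    define u where "u = d / (2 * norm h)"
    have u: "0 < u" "norm (u *\<^sub>R h) < d" using False d by (auto simp: u_def)
    have "u * norm (D h) = norm (D (u *\<^sub>R h))"
      using has_derivative_linear[OF D] u by (simp add: linear_scale)
    also have "\<dots> \<le> norm (F (z + u *\<^sub>R h) - F z - D (u *\<^sub>R h)) + norm (F (z + u *\<^sub>R h) - F z)"
      by (metis add.commute norm_minus_commute norm_triangle_sub)
    also have "\<dots> \<le> e / norm h * norm (u *\<^sub>R h) + C * norm (u *\<^sub>R h)"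
      using near[of "z + u *\<^sub>R h"] u lipschitz_on_normD[OF lip, of "z + u *\<^sub>R h" z]
      by (intro add_mono) auto
    also have "\<dots> = u * (C * norm h + e)"
      using False u by (simp add: field_simps)
    finally show "norm (D h) \<le> C * norm h + e" using u by simp
  qed
qed

lemma norm_adjoint_le:
  fixes D :: "'a::euclidean_space \<Rightarrow> 'b::euclidean_space"
  assumes "linear D" and bound: "\<And>h. norm (D h) \<le> C * norm h"
  shows "norm (adjoint D v) \<le> C * norm v"
proof (cases "adjoint D v = 0")
  case True
  obtain b :: 'a where "b \<in> Basis" using nonempty_Basis by blast
  then have "0 \<le> C" using order_trans[OF norm_ge_zero bound[of b]] by simp
  with True show ?thesis by simp
next
  case False
  have "(norm (adjoint D v))\<^sup>2 = D (adjoint D v) \<bullet> v"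
    using adjoint_works[OF assms(1)] by (metis power2_norm_eq_inner)
  also have "\<dots> \<le> norm (D (adjoint D v)) * norm v" by (rule norm_cauchy_schwarz)
  also have "\<dots> \<le> (C * norm (adjoint D v)) * norm v"
    by (intro mult_right_mono bound) auto
  finally show ?thesis using False by (simp add: power2_eq_square mult.commute mult.left_commute)
qed

section \<open>Dual cones\<close>

lemma dual_cone_facts:
  shows zero_in_dual_cone: "0 \<in> dual_cone K"
    and convex_dual_cone: "convex (dual_cone K)"
    and dual_cone_scale: "v \<in> dual_cone K \<Longrightarrow> 0 \<le> c \<Longrightarrow> c *\<^sub>R v \<in> dual_cone K"
  by (auto simp: dual_cone_def convex_def inner_add_left)

lemma closed_dual_cone: "closed (dual_cone K)"
proof -
  have "dual_cone K = (\<Inter>w\<in>K. {v. 0 \<le> w \<bullet> v})"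
    by (auto simp: dual_cone_def inner_commute)
  then show ?thesis
    using closed_halfspace_ge by (auto simp: intro!: closed_INT)
qed

text \<open>Let \<open>q\<close> be the projection of \<open>w\<close> onto the polar cone \<open>- K\<close>. Testing its variational inequality with
  multiples of \<open>q\<close> shows that \<open>w - q\<close> is orthogonal to \<open>q\<close>, and testing it with \<open>q - k\<close> for
  \<open>k \<in> K\<close> shows that \<open>w - q\<close> lies in the dual cone. Orthogonality then makes \<open>w - q\<close> the
  projection of \<open>w\<close> onto the dual cone.\<close>

lemma moreau_cone_decomposition:
  fixes K :: "'a::euclidean_space set"
  assumes K: "K \<noteq> {}" "cone K" "convex K" "closed K"
  defines "P \<equiv> \<lambda>w. closest_point (dual_cone K) w"
  shows moreau_cone_residual: "w - P w \<in> uminus ` K"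
    and moreau_cone_inner: "w \<bullet> P w = (norm (P w))\<^sup>2"
    and moreau_cone_dist: "proj_dist (uminus ` K) w = norm (P w)"
proof -
  define N where "N = uminus ` K"
  define q where "q = closest_point N w"
  have N: "closed N" "convex N" "N \<noteq> {}"
    unfolding N_def using K by (auto intro: closed_negations convex_negations)
  have scale: "c *\<^sub>R v \<in> N" if "v \<in> N" "0 \<le> c" for v c
    using that K(2) unfolding N_def cone_def by force
  have add: "u + v \<in> N" if "u \<in> N" "v \<in> N" for u v
  proof -
    \<comment> \<open>A cone that is convex is closed under sums: a sum is twice a midpoint.\<close>
    have "2 *\<^sub>R ((1/2) *\<^sub>R u + (1/2) *\<^sub>R v) \<in> N"
      using that N(2) by (intro scale convexD) auto
    then show ?thesis by (simp add: algebra_simps)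
  qed
  have qN: "q \<in> N" unfolding q_def using N by (intro closest_point_in_set) auto
  have dot: "(w - q) \<bullet> (v - q) \<le> 0" if "v \<in> N" for v
    unfolding q_def using N that by (intro closest_point_dot) auto
  have orth: "(w - q) \<bullet> q = 0"
    using dot[of "2 *\<^sub>R q"] dot[of "0 *\<^sub>R q"] scale[OF qN, of 2] scale[OF qN, of 0]
    by (auto simp: algebra_simps scaleR_2)
  have dual: "w - q \<in> dual_cone K"
    unfolding dual_cone_def
  proof safe
    fix k assume "k \<in> K"
    then have "q + (- k) \<in> N" using qN by (intro add) (auto simp: N_def)
    from dot[OF this] show "0 \<le> (w - q) \<bullet> k" by simp
  qed
  have "w - q = P w"
    unfolding P_def
  proof (rule closest_point_unique[OF convex_dual_cone closed_dual_cone dual], safe)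
    fix v assume v: "v \<in> dual_cone K"
    have "q \<bullet> v \<le> 0" using qN v by (auto simp: N_def dual_cone_def inner_commute)
    then have "(norm q)\<^sup>2 \<le> (norm (w - v))\<^sup>2"
      using orth inner_ge_zero[of "w - v - q"]
      by (simp add: power2_norm_eq_inner inner_diff_left inner_diff_right inner_commute)
    then show "dist w (w - q) \<le> dist w v"
      by (simp add: dist_norm)
  qed
  then have Pw: "P w = w - q" by simp
  show "w - P w \<in> uminus ` K" using qN by (simp add: Pw N_def)
  show "w \<bullet> P w = (norm (P w))\<^sup>2"
    unfolding Pw power2_norm_eq_inner using orth by (simp add: inner_diff_right inner_commute algebra_simps)
  show "proj_dist (uminus ` K) w = norm (P w)"
    unfolding proj_dist_def N_def[symmetric] q_def[symmetric] Pw by (rule norm_minus_commute)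
qed

lemma cone_convex_inner:
  assumes "cone_convex K G" and "v \<in> dual_cone K"
  shows "convex_on UNIV (\<lambda>z. G z \<bullet> v)"
proof (rule convex_onI)
  fix u z z' assume u: "0 < (u::real)" "u < 1"
  then have "(1 - u) *\<^sub>R G z + u *\<^sub>R G z' - G ((1 - u) *\<^sub>R z + u *\<^sub>R z') \<in> K"
    using assms(1)[unfolded cone_convex_def, rule_format, of "1 - u" z z'] by simp
  with assms(2) show "G ((1 - u) *\<^sub>R z + u *\<^sub>R z') \<bullet> v \<le> (1 - u) * (G z \<bullet> v) + u * (G z' \<bullet> v)"
    by (auto simp: dual_cone_def inner_commute inner_diff_right inner_add_right)
qed auto

section \<open>The proximal step\<close>

lemma breg_convex_combination:
  fixes z z' c :: "'a::real_inner"
  shows "breg (u *\<^sub>R z + (1 - u) *\<^sub>R z') c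
    = u * breg z c + (1 - u) * breg z' c - u * (1 - u) * breg z z'"
  unfolding breg_def power2_norm_eq_inner
  by (simp add: inner_add_left inner_add_right inner_diff_left inner_diff_right inner_commute field_simps)

lemma breg_nonneg: "0 \<le> breg z c"
  by (simp add: breg_def)

text \<open>The proximal objective is strongly convex with modulus \<open>\<mu> + 1 / t\<close>, so at its minimiser \<open>x'\<close> it grows
  at least quadratically. To see this, compare the minimum with the value at \<open>u z + (1 - u) x'\<close>,
  divide by \<open>u\<close> and let \<open>u\<close> tend to \<open>0\<close>.\<close>

lemma prox_three_point:
  fixes f :: "'a::real_inner \<Rightarrow> ereal"
  assumes proper: "\<And>z. f z \<noteq> -\<infinity>" and conv: "econvex_mod \<mu> f" 
    and min: "is_arg_min (\<lambda>z. f z + ereal (s \<bullet> z + 1 / t * breg z c)) (\<lambda>_. True) x'"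
    and z: "z \<in> edom f"
  shows prox_in_edom: "x' \<in> edom f"
    and "real_of_ereal (f x') + s \<bullet> x' + breg x' c / t + (\<mu> + 1 / t) * breg z x'
      \<le> real_of_ereal (f z) + s \<bullet> z + breg z c / t"
proof -
  have le: "f x' + ereal (s \<bullet> x' + 1 / t * breg x' c) \<le> f v + ereal (s \<bullet> v + 1 / t * breg v c)" for v
    using min by (auto simp: is_arg_min_def not_less)
  obtain a where a: "f z = ereal a"
    using z proper[of z] by (cases "f z") (auto simp: edom_def)
  from le[of z] obtain b where b: "f x' = ereal b"
    using a proper[of x'] by (cases "f x'") auto
  then show "x' \<in> edom f" by (simp add: edom_def)
  define r where "r = a + s \<bullet> z + breg z c / t - (b + s \<bullet> x' + breg x' c / t)"
  define d where "d = (\<mu> + 1 / t) * breg z x'"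
  have "(1 - u) * d \<le> r" if u: "0 < u" "u < 1" for u
  proof -
    define w where "w = u *\<^sub>R z + (1 - u) *\<^sub>R x'"
    have fw: "f w + ereal (\<mu> * u * (1 - u) * breg z x') \<le> ereal (u * a + (1 - u) * b)"
      using conv[unfolded econvex_mod_def, rule_format, of u z x'] u
      by (simp add: w_def breg_def a b)
    then obtain e where e: "f w = ereal e" using proper[of w] by (cases "f w") auto
    have "b + s \<bullet> x' + breg x' c / t \<le> e + s \<bullet> w + breg w c / t"
      using le[of w] by (simp add: b e)
    also have "\<dots> \<le> u * a + (1 - u) * b - \<mu> * u * (1 - u) * breg z x' + s \<bullet> w + breg w c / t"
      using fw e by simp
    also have "\<dots> = u * (a + s \<bullet> z + breg z c / t) + (1 - u) * (b + s \<bullet> x' + breg x' c / t)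
        - u * (1 - u) * d"
      unfolding w_def breg_convex_combination d_def
      by (simp add: inner_add_right add_divide_distrib diff_divide_distrib algebra_simps)
    finally have "u * ((1 - u) * d) \<le> u * r" unfolding r_def by argo
    then show ?thesis using u by simp
  qed
  then have ev: "eventually (\<lambda>u. (1 - u) * d \<le> r) (at_right 0)"
    by (auto simp: eventually_at_right[of 0 1] intro!: exI[of _ 1])
  have "((\<lambda>u. (1 - u) * d) \<longlongrightarrow> (1 - 0) * d) (at_right 0)"
    by (intro tendsto_intros)
  from tendsto_upperbound[OF this ev] have "d \<le> r" by simp
  then show "real_of_ereal (f x') + s \<bullet> x' + breg x' c / t + (\<mu> + 1 / t) * breg z x'
      \<le> real_of_ereal (f z) + s \<bullet> z + breg z c / t"
    by (simp add: a b r_def d_def)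
qed

lemma econvex_mod_convex_on:
  fixes f :: "'a::real_normed_vector \<Rightarrow> ereal"
  assumes proper: "\<And>z. f z \<noteq> -\<infinity>" and conv: "econvex_mod \<mu> f" and "0 \<le> \<mu>"
  shows "convex_on (edom f) (\<lambda>z. real_of_ereal (f z))"
proof -
  have *: "(1 - u) *\<^sub>R z + u *\<^sub>R z' \<in> edom f \<and>
      real_of_ereal (f ((1 - u) *\<^sub>R z + u *\<^sub>R z'))
        \<le> (1 - u) * real_of_ereal (f z) + u * real_of_ereal (f z')"
    if u: "0 < u" "u < 1" and z: "z \<in> edom f" "z' \<in> edom f" for u z z'
  proof -
    obtain a where a: "f z = ereal a"
      using z proper[of z] by (cases "f z") (auto simp: edom_def)
    obtain b where b: "f z' = ereal b"
      using z proper[of z'] by (cases "f z'") (auto simp: edom_def)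
    define w where "w = (1 - u) *\<^sub>R z + u *\<^sub>R z'"
    have "f w + ereal (\<mu> / 2 * (1 - u) * u * (norm (z - z'))\<^sup>2) \<le> ereal ((1 - u) * a + u * b)"
      using conv[unfolded econvex_mod_def, rule_format, of "1 - u" z z'] u
      unfolding w_def by (simp add: a b)
    moreover have "0 \<le> \<mu> / 2 * (1 - u) * u * (norm (z - z'))\<^sup>2" using u assms(3) by simp
    ultimately show ?thesis
      using proper[of w] unfolding w_def[symmetric] by (cases "f w") (auto simp: edom_def a b)
  qed
  have "convex (edom f)"
    unfolding convex_alt
  proof (intro ballI allI impI)
    fix z z' :: 'a and u :: real assume "z \<in> edom f" "z' \<in> edom f" "0 \<le> u \<and> u \<le> 1"
    then show "(1 - u) *\<^sub>R z + u *\<^sub>R z' \<in> edom f"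
      using *[of u z z'] by (cases "u = 0 \<or> u = 1") auto
  qed
  with * show ?thesis by (auto intro: convex_onI)
qed

lemma econvex_mod_ind_fun: "convex S \<Longrightarrow> econvex_mod 0 (ind_fun S)"
  by (auto simp: econvex_mod_def ind_fun_def convex_def)

lemma edom_ind_fun [simp]: "edom (ind_fun S) = S"
  by (auto simp: edom_def ind_fun_def split: if_splits)

lemma young_inequality:
  fixes a w :: "'a::real_inner"
  assumes "0 < \<alpha>"
  shows "a \<bullet> w \<le> (norm a)\<^sup>2 / (2 * \<alpha>) + \<alpha> * ((norm w)\<^sup>2 / 2)"
proof -
  have "0 \<le> (norm (a - \<alpha> *\<^sub>R w))\<^sup>2" by simp
  also have "\<dots> = (norm a)\<^sup>2 - 2 * \<alpha> * (a \<bullet> w) + \<alpha>\<^sup>2 * (norm w)\<^sup>2"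
    unfolding power2_norm_eq_inner
    by (simp add: inner_diff_left inner_diff_right inner_commute power2_eq_square)
  finally show ?thesis using assms by (simp add: field_simps power2_eq_square)
qed

section \<open>The energy estimate\<close>

text \<open>Arbitrary Euclidean spaces stand in for \<open>\<real>\<^sup>n\<close> and \<open>\<real>\<^sup>m\<close>, so that derivatives can be handled as
  linear maps with adjoints instead of matrices.\<close>

locale apdb_conic =
  fixes f :: "'a::euclidean_space \<Rightarrow> ereal" and g :: "'a \<Rightarrow> real"
    and G :: "'a \<Rightarrow> 'b::euclidean_space" and K :: "'b set" and p :: apdb_params
    and \<Phi> :: "'a \<Rightarrow> 'b \<Rightarrow> real"
    and x :: "nat \<Rightarrow> 'a" and y :: "nat \<Rightarrow> 'b" and \<tau> \<gamma> :: "nat \<Rightarrow> real"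
  assumes f_proper: "\<And>z. f z \<noteq> -\<infinity>" and f_convex: "econvex_mod (p_mu p) f"
    and g_convex: "convex_on UNIV g" and g_diff: "\<And>z. g differentiable (at z)"
    and G_convex: "cone_convex K G" and G_diff: "\<And>z. G differentiable (at z)"
    and \<Phi>: "\<And>z v. \<Phi> z v = g z + G z \<bullet> v"
    and params: "valid_params p"
    and start: "x 0 \<in> edom f" "y 0 \<in> dual_cone K"
    and run: "apdb_run p f (ind_fun (dual_cone K)) \<Phi> (x 0) (y 0) x y \<tau> \<gamma>"
begin

abbreviation fr :: "'a \<Rightarrow> real" where "fr z \<equiv> real_of_ereal (f z)"
abbreviation \<sigma>\<^sub>p :: "nat \<Rightarrow> real" where "\<sigma>\<^sub>p \<equiv> sigma_prev p \<tau> \<gamma>"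
abbreviation x\<^sub>p :: "nat \<Rightarrow> 'a" where "x\<^sub>p \<equiv> prev (x 0) x"
abbreviation y\<^sub>p :: "nat \<Rightarrow> 'b" where "y\<^sub>p \<equiv> prev (y 0) y"

definition \<sigma> :: "nat \<Rightarrow> real" where "\<sigma> k = \<gamma> k * \<tau> k"
definition \<alpha> :: "nat \<Rightarrow> real" where "\<alpha> k = p_calpha p / tau_prev p \<tau> k"
definition \<beta> :: "nat \<Rightarrow> real" where "\<beta> k = p_gamma p * p_cbeta p / \<sigma>\<^sub>p k"

text \<open>The gradient of \<open>\<Phi> \<cdot> v\<close>; the adjoint is the transposed Jacobian of \<open>G\<close>.\<close>

definition grad :: "'a \<Rightarrow> 'b \<Rightarrow> 'a" where
  "grad z v = gradient g z + adjoint (frechet_derivative G (at z)) v"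

text \<open>The change of \<open>\<nabla>\<^sub>x\<Phi>\<close> over one iteration, which the algorithm uses for extrapolation. It is split at
  \<open>(x\<^sub>k, y\<^sub>k\<^sub>-\<^sub>1)\<close> into the change in \<open>y\<close> and the change in \<open>x\<close>; \<open>A\<close> below collects the squares that
  Young's inequality with weights \<open>\<alpha>\<close> and \<open>\<beta>\<close> produces from these two parts. They are the squares
  that the acceptance test of the previous iteration controls.\<close>

definition q :: "nat \<Rightarrow> 'a" where
  "q k = grad (x k) (y k) - grad (x\<^sub>p k) (y\<^sub>p k)"

definition A :: "nat \<Rightarrow> real" where
  "A k = (norm (grad (x k) (y k) - grad (x k) (y\<^sub>p k)))\<^sup>2 / (2 * \<alpha> k)
       + (norm (grad (x k) (y\<^sub>p k) - grad (x\<^sub>p k) (y\<^sub>p k)))\<^sup>2 / (2 * \<beta> k)"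

definition gap :: "'a \<Rightarrow> 'b \<Rightarrow> nat \<Rightarrow> real" where
  "gap z v k = fr (x (Suc k)) + \<Phi> (x (Suc k)) v - (fr z + \<Phi> z (y (Suc k)))"

text \<open>The quantity that one iteration passes on to the next. The inner product is the part of
  the extrapolation error that telescopes, and \<open>A\<close> pays for the part that does not.\<close>

definition V :: "'a \<Rightarrow> 'b \<Rightarrow> nat \<Rightarrow> real" where
  "V z v k = \<gamma> k * breg z (x k) + breg v (y k)
     - \<sigma>\<^sub>p k * (q k \<bullet> (x k - z)) + \<sigma>\<^sub>p k * A k"

lemma p_pos:
  "0 \<le> p_mu p" "0 < p_eta p" "p_eta p < 1" "0 < p_tau p" "0 < p_gamma p" "0 \<le> p_delta p"
  "p_delta p < 1" "0 < p_calpha p" "0 < p_cbeta p" "p_calpha p + p_cbeta p + p_delta p < 1"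
  using params by (auto simp: valid_params_def)

lemma \<gamma>_0: "\<gamma> 0 = p_gamma p" and \<gamma>_Suc: "\<gamma> (Suc k) = \<gamma> k * (1 + p_mu p * \<tau> k)"
  using run by (auto simp: apdb_run_def)

lemma trial: "apdb_trial p f (ind_fun (dual_cone K)) \<Phi> x y \<tau> \<gamma> k (\<tau> k) (x (Suc k)) (y (Suc k))"
  and accept: "apdb_accept p \<Phi> x y \<tau> \<gamma> k (\<tau> k) (x (Suc k)) (y (Suc k))"
  using run unfolding apdb_run_def by blast+

lemma backtracking:
  obtains j where "\<tau> k = p_eta p ^ j * tau_trial p \<tau> \<gamma> k"
    and "\<And>i. i < j \<Longrightarrow> \<exists>x' y'. \<not> apdb_accept p \<Phi> x y \<tau> \<gamma> k (p_eta p ^ i * tau_trial p \<tau> \<gamma> k) x' y'"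
  using run unfolding apdb_run_def by blast

text \<open>Positivity must be proved jointly: the next trial step involves the quotient of two consecutive
  values of \<open>\<gamma>\<close>, and the next \<open>\<gamma>\<close> involves the accepted step.\<close>

lemma \<gamma>_\<tau>_pos: "0 < \<gamma> k \<and> 0 < tau_trial p \<tau> \<gamma> k \<and> 0 < \<tau> k"
proof (induction k)
  case 0
  from backtracking[of 0] show ?case
    using p_pos by (metis \<gamma>_0 mult_pos_pos nat.case(1) prev_def tau_trial_def zero_less_power)
next
  case (Suc k)
  then have "0 < \<gamma> (Suc k)" using p_pos(1) by (simp add: \<gamma>_Suc add_pos_nonneg)
  moreover from this Suc have "0 < tau_trial p \<tau> \<gamma> (Suc k)"
    by (simp add: tau_trial_def prev_def)
  ultimately show ?case
    using backtracking[of "Suc k"] p_pos(2) by (metis mult_pos_pos zero_less_power)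
qed

lemma \<gamma>_pos: "0 < \<gamma> k" and \<tau>_pos: "0 < \<tau> k" and tau_trial_pos: "0 < tau_trial p \<tau> \<gamma> k"
  and \<sigma>_pos: "0 < \<sigma> k"
  using \<gamma>_\<tau>_pos by (auto simp: \<sigma>_def)

lemma \<gamma>_mono: "\<gamma> k \<le> \<gamma> (Suc k)"
  using \<gamma>_pos[of k] \<tau>_pos[of k] p_pos(1) by (simp add: \<gamma>_Suc algebra_simps)

lemma \<gamma>_ge_0: "\<gamma> 0 \<le> \<gamma> k"
  by (induction k) (auto intro: order_trans \<gamma>_mono)

lemma \<sigma>\<^sub>p_pos: "0 < \<sigma>\<^sub>p k" and tau_prev_pos: "0 < tau_prev p \<tau> k"
  using \<gamma>_pos \<tau>_pos p_pos
  by (auto simp: sigma_prev_def tau_prev_def prev_def split: nat.split)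

lemma \<alpha>_pos: "0 < \<alpha> k" and \<beta>_pos: "0 < \<beta> k"
  using \<sigma>\<^sub>p_pos tau_prev_pos p_pos by (auto simp: \<alpha>_def \<beta>_def)

text \<open>The weights carried over from the previous iteration never exceed the fraction
  \<open>c\<^sub>\<alpha> + c\<^sub>\<beta> < 1\<close> of the current weight \<open>\<gamma>\<^sub>k\<close>, because \<open>\<sigma>\<^sub>k\<^sub>-\<^sub>1 = \<gamma>\<^sub>k\<^sub>-\<^sub>1 \<tau>\<^sub>k\<^sub>-\<^sub>1\<close> and \<open>\<gamma>\<close> is nondecreasing. The same
  fact makes the energy nonnegative and leaves room for short steps in the acceptance test.\<close>

lemma previous_weight: "\<sigma>\<^sub>p k * (\<alpha> k + \<beta> k) \<le> \<gamma> k * (p_calpha p + p_cbeta p)"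
proof -
  have "\<sigma>\<^sub>p k \<le> \<gamma> k * tau_prev p \<tau> k"
    using \<gamma>_mono \<tau>_pos
    by (auto simp: sigma_prev_def tau_prev_def prev_def \<gamma>_0 mult_right_mono less_imp_le split: nat.split)
  then have "\<sigma>\<^sub>p k * \<alpha> k \<le> \<gamma> k * p_calpha p"
    using p_pos tau_prev_pos[of k] by (simp add: \<alpha>_def divide_simps mult_right_mono mult.commute mult.left_commute)
  moreover have "\<sigma>\<^sub>p k * \<beta> k \<le> \<gamma> k * p_cbeta p"
    using \<sigma>\<^sub>p_pos[of k] \<gamma>_ge_0[of k] p_pos by (simp add: \<beta>_def \<gamma>_0)
  ultimately show ?thesis by (simp add: distrib_left)
qed

lemma GDERIV_\<Phi>: "GDERIV (\<lambda>z. \<Phi> z v) z :> grad z v"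
proof -
  have "(g has_derivative (\<lambda>h. h \<bullet> gradient g z)) (at z)"
    using GDERIV_gradient[OF g_diff] by (simp add: gderiv_def)
  moreover have "(G has_derivative frechet_derivative G (at z)) (at z)"
    using G_diff frechet_derivative_works by blast
  ultimately have "((\<lambda>z. \<Phi> z v) has_derivative
      (\<lambda>h. h \<bullet> gradient g z + frechet_derivative G (at z) h \<bullet> v)) (at z)"
    unfolding \<Phi> by (auto intro!: derivative_eq_intros)
  then show ?thesis
    by (simp add: gderiv_def grad_def inner_add_right adjoint_works linear_frechet_derivative G_diff)
qed

lemma gradient_\<Phi>: "gradient (\<lambda>z. \<Phi> z v) z = grad z v"
  by (rule gradient_eqI) (rule GDERIV_\<Phi>)

lemma gradient_\<Phi>_dual: "gradient (\<Phi> z) v = G z"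
proof (rule gradient_eqI)
  have "((\<lambda>v. \<Phi> z v) has_derivative (\<lambda>h. h \<bullet> G z)) (at v)"
    unfolding \<Phi> by (auto intro!: derivative_eq_intros simp: inner_commute)
  then show "GDERIV (\<Phi> z) v :> G z" by (simp add: gderiv_def)
qed

lemma convex_on_\<Phi>: "v \<in> dual_cone K \<Longrightarrow> convex_on UNIV (\<lambda>z. \<Phi> z v)"
  unfolding \<Phi> by (intro convex_on_add g_convex cone_convex_inner[OF G_convex])

lemma primal_prox_step:
  fixes k
  defines "s \<equiv> (1 + \<sigma>\<^sub>p k / \<sigma> k) *\<^sub>R grad (x k) (y k) - (\<sigma>\<^sub>p k / \<sigma> k) *\<^sub>R grad (x\<^sub>p k) (y\<^sub>p k)"
  assumes z: "z \<in> edom f"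
  shows primal_iterate_in_edom: "x (Suc k) \<in> edom f"
    and "fr (x (Suc k)) + s \<bullet> x (Suc k) + breg (x (Suc k)) (x k) / \<tau> k
        + (p_mu p + 1 / \<tau> k) * breg z (x (Suc k))
      \<le> fr z + s \<bullet> z + breg z (x k) / \<tau> k"
proof -
  have "is_arg_min (\<lambda>z. f z + ereal (s \<bullet> z + 1 / \<tau> k * breg z (x k))) (\<lambda>_. True) (x (Suc k))"
    using trial[of k] by (simp add: apdb_trial_def Let_def gradient_\<Phi> s_def \<sigma>_def)
  note prox = prox_three_point[OF f_proper f_convex this z]
  show "x (Suc k) \<in> edom f" by (rule prox(1))
  show "fr (x (Suc k)) + s \<bullet> x (Suc k) + breg (x (Suc k)) (x k) / \<tau> k
        + (p_mu p + 1 / \<tau> k) * breg z (x (Suc k))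
      \<le> fr z + s \<bullet> z + breg z (x k) / \<tau> k" by (rule prox(2))
qed

lemma dual_prox_step:
  assumes v: "v \<in> dual_cone K"
  shows dual_iterate_in_cone: "y (Suc k) \<in> dual_cone K"
    and "- (G (x (Suc k)) \<bullet> y (Suc k)) + breg (y (Suc k)) (y k) / \<sigma> k + breg v (y (Suc k)) / \<sigma> k
      \<le> - (G (x (Suc k)) \<bullet> v) + breg v (y k) / \<sigma> k"
proof -
  have argmin: "is_arg_min (\<lambda>v. ind_fun (dual_cone K) v
      + ereal ((- G (x (Suc k))) \<bullet> v + 1 / \<sigma> k * breg v (y k))) (\<lambda>_. True) (y (Suc k))"
    using trial[of k] by (simp add: apdb_trial_def Let_def gradient_\<Phi>_dual \<sigma>_def)
  have proper: "ind_fun (dual_cone K) w \<noteq> -\<infinity>" for w by (simp add: ind_fun_def)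
  have dom: "v \<in> edom (ind_fun (dual_cone K))" using v by simp
  note prox = prox_three_point[OF proper econvex_mod_ind_fun[OF convex_dual_cone] argmin dom]
  from prox(1) show mem: "y (Suc k) \<in> dual_cone K" by simp
  show "- (G (x (Suc k)) \<bullet> y (Suc k)) + breg (y (Suc k)) (y k) / \<sigma> k + breg v (y (Suc k)) / \<sigma> k
      \<le> - (G (x (Suc k)) \<bullet> v) + breg v (y k) / \<sigma> k"
    using prox(2) mem v by (simp add: ind_fun_def)
qed

lemma x_in_edom: "x k \<in> edom f"
  using start primal_iterate_in_edom[OF start(1)] by (cases k) auto

lemma y_in_dual_cone: "y k \<in> dual_cone K"
  using start dual_iterate_in_cone[OF start(2)] by (cases k) auto

lemma momentum_bound: "q k \<bullet> w \<le> A k + (\<alpha> k + \<beta> k) * ((norm w)\<^sup>2 / 2)"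
proof -
  have "q k \<bullet> w = (grad (x k) (y k) - grad (x k) (y\<^sub>p k)) \<bullet> w
      + (grad (x k) (y\<^sub>p k) - grad (x\<^sub>p k) (y\<^sub>p k)) \<bullet> w"
    by (simp add: q_def inner_diff_left)
  then show ?thesis
    using young_inequality[OF \<alpha>_pos, of "grad (x k) (y k) - grad (x k) (y\<^sub>p k)" w k]
      young_inequality[OF \<beta>_pos, of "grad (x k) (y\<^sub>p k) - grad (x\<^sub>p k) (y\<^sub>p k)" w k]
    unfolding A_def by (simp add: distrib_right add_divide_distrib)
qed

text \<open>For the accepted step the primed coefficients of the test are the values of \<open>\<alpha>\<close> and \<open>\<beta>\<close> with index
  \<open>k + 1\<close>, so the test controls \<open>A\<close> of the next iteration.\<close>

lemma apdb_E_accepted: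
  "apdb_E p \<Phi> x y \<tau> \<gamma> k (\<tau> k) (x (Suc k)) (y (Suc k)) =
    A (Suc k) - breg (y (Suc k)) (y k) / \<sigma> k
      - (1 / \<tau> k - \<sigma>\<^sub>p k / \<sigma> k * (\<alpha> k + \<beta> k)) * breg (x (Suc k)) (x k)"
  unfolding apdb_E_def Let_def gradient_\<Phi> A_def \<alpha>_def \<beta>_def \<sigma>_def
  by (simp add: prev_def tau_prev_def sigma_prev_def mult.commute)

lemma accepted_test:
  "A (Suc k) - breg (y (Suc k)) (y k) / \<sigma> k
      - (1 / \<tau> k - \<sigma>\<^sub>p k / \<sigma> k * (\<alpha> k + \<beta> k)) * breg (x (Suc k)) (x k) \<le> 0"
proof -
  have "0 \<le> p_delta p / \<tau> k * breg (x (Suc k)) (x k)"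
    "0 \<le> p_delta p / (\<gamma> k * \<tau> k) * breg (y (Suc k)) (y k)"
    using p_pos(6) \<tau>_pos[of k] \<gamma>_pos[of k]
    by (auto intro!: mult_nonneg_nonneg divide_nonneg_nonneg breg_nonneg)
  then have "- (p_delta p / \<tau> k) * breg (x (Suc k)) (x k)
      - p_delta p / (\<gamma> k * \<tau> k) * breg (y (Suc k)) (y k) \<le> 0"
    by simp
  then show ?thesis using accept[of k] unfolding apdb_accept_def apdb_E_accepted by linarith
qed

text \<open>The heart of the proof. It adds up five inequalities: the three-point inequalities of the primal and
  of the dual subproblem, convexity of \<open>\<Phi> \<cdot> y\<^sub>k\<^sub>+\<^sub>1\<close>, the acceptance test, and Young's inequality for the
  non-telescoping part \<open>\<theta> q\<^sub>k \<bullet> (x\<^sub>k\<^sub>+\<^sub>1 - x\<^sub>k)\<close> of the extrapolation error.\<close>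

lemma energy_step:
  assumes z: "z \<in> edom f" and v: "v \<in> dual_cone K"
  shows "\<sigma> k * gap z v k \<le> V z v k - V z v (Suc k)"
proof -
  define X Y \<theta> where "X = x (Suc k)" and "Y = y (Suc k)" and "\<theta> = \<sigma>\<^sub>p k / \<sigma> k"
  define s where "s = (1 + \<theta>) *\<^sub>R grad (x k) (y k) - \<theta> *\<^sub>R grad (x\<^sub>p k) (y\<^sub>p k)"
  have \<theta>: "0 \<le> \<theta>" using \<sigma>\<^sub>p_pos[of k] \<sigma>_pos[of k] by (simp add: \<theta>_def)
  have primal: "fr X + s \<bullet> X + breg X (x k) / \<tau> k + (p_mu p + 1 / \<tau> k) * breg z X
      \<le> fr z + s \<bullet> z + breg z (x k) / \<tau> k"
    using primal_prox_step(2)[OF z, of k] by (simp add: X_def s_def \<theta>_def)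
  have dual: "- (G X \<bullet> Y) + breg Y (y k) / \<sigma> k + breg v Y / \<sigma> k \<le> - (G X \<bullet> v) + breg v (y k) / \<sigma> k"
    using dual_prox_step(2)[OF v, of k] by (simp add: X_def Y_def)
  have conv: "\<Phi> X Y + grad X Y \<bullet> (z - X) \<le> \<Phi> z Y"
    using convex_gradient_inequality[OF convex_on_\<Phi>[OF y_in_dual_cone[of "Suc k"]] GDERIV_\<Phi>]
    by (simp add: Y_def)
  have test: "A (Suc k) - breg Y (y k) / \<sigma> k - breg X (x k) / \<tau> k
      + \<theta> * (\<alpha> k + \<beta> k) * breg X (x k) \<le> 0"
    using accepted_test[of k] by (simp add: X_def Y_def \<theta>_def left_diff_distrib)
  have mom: "\<theta> * (- (q k \<bullet> (X - x k))) \<le> \<theta> * A k + \<theta> * (\<alpha> k + \<beta> k) * breg X (x k)"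
    using mult_left_mono[OF momentum_bound[of k "- (X - x k)"] \<theta>]
    by (simp add: breg_def algebra_simps add_divide_distrib norm_minus_commute)
  have qS: "q (Suc k) = grad X Y - grad (x k) (y k)"
    by (simp add: q_def X_def Y_def prev_def)
  have split: "s \<bullet> X - s \<bullet> z + grad X Y \<bullet> (z - X)
      = - (q (Suc k) \<bullet> (X - z)) + \<theta> * (q k \<bullet> (X - x k)) + \<theta> * (q k \<bullet> (x k - z))"
    unfolding qS by (simp add: s_def q_def algebra_simps)
  have "gap z v k \<le> (breg z (x k) / \<tau> k + breg v (y k) / \<sigma> k - \<theta> * (q k \<bullet> (x k - z)) + \<theta> * A k)
      - ((p_mu p + 1 / \<tau> k) * breg z X + breg v Y / \<sigma> k - q (Suc k) \<bullet> (X - z) + A (Suc k))"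
    (is "_ \<le> ?R")
    using primal dual conv test mom split
    unfolding gap_def X_def[symmetric] Y_def[symmetric] \<Phi>[of X] by argo
  then have "\<sigma> k * gap z v k \<le> \<sigma> k * ?R"
    using \<sigma>_pos[of k] by simp
  also have "\<sigma> k * ?R = V z v k - V z v (Suc k)"
  proof -
    \<comment> \<open>The weight of \<open>D z x\<^sub>k\<^sub>+\<^sub>1\<close> becomes \<open>\<gamma>\<^sub>k\<^sub>+\<^sub>1\<close> by the update rule for \<open>\<gamma>\<close>.\<close>
    have coeffs: "\<sigma> k * \<theta> = \<sigma>\<^sub>p k" "\<sigma>\<^sub>p (Suc k) = \<sigma> k"
      "\<sigma> k * (breg z (x k) / \<tau> k) = \<gamma> k * breg z (x k)"
      "\<sigma> k * ((p_mu p + 1 / \<tau> k) * breg z X) = \<gamma> (Suc k) * breg z X"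
      "\<sigma> k * (breg v (y k) / \<sigma> k) = breg v (y k)"
      "\<sigma> k * (breg v Y / \<sigma> k) = breg v Y"
      using \<sigma>_pos[of k] \<tau>_pos[of k]
      by (auto simp: \<theta>_def \<sigma>_def \<gamma>_Suc sigma_prev_def prev_def field_simps)
    show ?thesis
      unfolding V_def X_def[symmetric] Y_def[symmetric] coeffs(2) coeffs(1)[symmetric]
      unfolding right_diff_distrib distrib_left coeffs(3-6)
      using coeffs(4) by (simp add: distrib_left mult.assoc)
  qed
  finally show ?thesis .
qed

lemma V_0: "V z v 0 = \<gamma> 0 * breg z (x 0) + breg v (y 0)"
  by (simp add: V_def q_def A_def prev_def)

text \<open>Young's inequality bounds the inner product in \<open>V\<close> by \<open>A\<close> and a multiple of \<open>D z x\<^sub>k\<close>, which the first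
  summand of \<open>V\<close> absorbs.\<close>

lemma breg_le_V: "breg v (y k) \<le> V z v k"
proof -
  have "\<sigma>\<^sub>p k * (q k \<bullet> (x k - z)) \<le> \<sigma>\<^sub>p k * (A k + (\<alpha> k + \<beta> k) * breg z (x k))"
    using momentum_bound[of k "x k - z"] \<sigma>\<^sub>p_pos[of k]
    by (simp add: breg_def norm_minus_commute)
  also have "\<dots> = \<sigma>\<^sub>p k * A k + (\<sigma>\<^sub>p k * (\<alpha> k + \<beta> k)) * breg z (x k)"
    by (simp add: algebra_simps)
  also have "(\<sigma>\<^sub>p k * (\<alpha> k + \<beta> k)) * breg z (x k) \<le> (\<gamma> k * 1) * breg z (x k)"
    using p_pos \<gamma>_pos[of k]
    by (intro mult_right_mono breg_nonneg order_trans[OF previous_weight] mult_left_mono) auto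
  finally show ?thesis by (simp add: V_def)
qed

lemma energy_sum:
  assumes "z \<in> edom f" "v \<in> dual_cone K"
  shows "(\<Sum>k<N. \<sigma> k * gap z v k) + breg v (y N) \<le> \<gamma> 0 * breg z (x 0) + breg v (y 0)"
proof -
  have "(\<Sum>k<N. \<sigma> k * gap z v k) \<le> (\<Sum>k<N. V z v k - V z v (Suc k))"
    by (intro sum_mono energy_step assms)
  also have "\<dots> = V z v 0 - V z v N" by (rule sum_lessThan_telescope')
  finally show ?thesis using breg_le_V[of v N z] by (simp add: V_0)
qed

end

section \<open>Bounded dual iterates and the ergodic rate\<close>

locale apdb_saddle = apdb_conic +
  fixes xs :: 'a and ys :: 'b
  assumes K_cone: "K \<noteq> {}" "cone K" "convex K" "closed K"
    and saddle: "saddle_point UNIV (dual_cone K) (\<lambda>z v. f z + ereal (g z) + ereal (G z \<bullet> v)) xs ys"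
begin

lemma ys_dual: "ys \<in> dual_cone K"
  and saddle_le: "v \<in> dual_cone K \<Longrightarrow>
    f xs + ereal (g xs) + ereal (G xs \<bullet> v) \<le> f xs + ereal (g xs) + ereal (G xs \<bullet> ys)"
  and saddle_ge: "f xs + ereal (g xs) + ereal (G xs \<bullet> ys) \<le> f z + ereal (g z) + ereal (G z \<bullet> ys)"
  using saddle by (auto simp: saddle_point_def)

lemma edomE:
  assumes "z \<in> edom f"
  obtains r where "f z = ereal r"
  using assms f_proper[of z] by (cases "f z") (auto simp: edom_def)

lemma xs_in_edom: "xs \<in> edom f"
proof -
  obtain r where "f (x 0) = ereal r" using start(1) by (rule edomE)
  then show ?thesis using saddle_ge[of "x 0"] by (cases "f xs") (auto simp: edom_def)
qed

text \<open>At \<open>x\<^sup>*\<close> the saddle function is affine in \<open>v\<close> and maximal over the dual cone at \<open>y\<^sup>*\<close>;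
  comparing with \<open>v = 0\<close> and \<open>v = 2 y\<^sup>*\<close> forces the linear term to vanish at \<open>y\<^sup>*\<close>.\<close>

lemma complementary_slackness: "G xs \<bullet> ys = 0"
  and primal_feasible: "v \<in> dual_cone K \<Longrightarrow> G xs \<bullet> v \<le> 0"
proof -
  obtain r where "f xs = ereal r" using xs_in_edom by (rule edomE)
  then have le: "G xs \<bullet> v \<le> G xs \<bullet> ys" if "v \<in> dual_cone K" for v
    using saddle_le[OF that] by simp
  from le[OF zero_in_dual_cone] le[OF dual_cone_scale[OF ys_dual, of 2]]
  show "G xs \<bullet> ys = 0" by simp
  then show "G xs \<bullet> v \<le> 0" if "v \<in> dual_cone K" using le[OF that] by simp
qed

lemma lagrangian_lower_bound:
  assumes "z \<in> edom f"
  shows "fr xs + g xs \<le> fr z + g z + G z \<bullet> ys"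
proof -
  obtain a b where "f xs = ereal a" "f z = ereal b"
    using xs_in_edom assms by (metis edomE)
  then show ?thesis using saddle_ge[of z] by (simp add: complementary_slackness)
qed

text \<open>Feasibility of \<open>x\<^sup>*\<close> and \<open>y\<^sub>k\<^sub>+\<^sub>1\<close> in the dual cone give \<open>G x\<^sup>* \<bullet> y\<^sub>k\<^sub>+\<^sub>1 \<le> 0\<close>, so the gap at \<open>x\<^sup>*\<close>
  dominates a Lagrangian difference in which the iterates occur only through \<open>x\<^sub>k\<^sub>+\<^sub>1\<close>. This is what
  allows averaging over the primal iterates alone.\<close>

lemma gap_ge_lagrangian:
  "fr (x (Suc k)) + g (x (Suc k)) + G (x (Suc k)) \<bullet> v - (fr xs + g xs) \<le> gap xs v k"
  using primal_feasible[OF y_in_dual_cone[of "Suc k"]] by (simp add: gap_def \<Phi>)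

lemma dual_distance_bound:
  "(norm (ys - y k))\<^sup>2 \<le> p_gamma p * (norm (xs - x 0))\<^sup>2 + (norm (ys - y 0))\<^sup>2"
proof -
  have "0 \<le> gap xs ys j" for j
    using gap_ge_lagrangian[of j ys] lagrangian_lower_bound[OF x_in_edom[of "Suc j"]] by simp
  then have "0 \<le> (\<Sum>j<k. \<sigma> j * gap xs ys j)"
    by (intro sum_nonneg mult_nonneg_nonneg) (auto intro: less_imp_le \<sigma>_pos)
  then have "breg ys (y k) \<le> \<gamma> 0 * breg xs (x 0) + breg ys (y 0)"
    using energy_sum[OF xs_in_edom ys_dual, of k] by simp
  then show ?thesis by (simp add: breg_def \<gamma>_0)
qed

lemma dual_iterates_bounded:
  "norm (y k) \<le> norm ys + sqrt (p_gamma p * (norm (xs - x 0))\<^sup>2 + (norm (ys - y 0))\<^sup>2)"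
proof -
  have "norm (y k) \<le> norm ys + norm (ys - y k)"
    by (metis norm_minus_commute norm_triangle_sub)
  with real_le_rsqrt[OF dual_distance_bound[of k]] show ?thesis by linarith
qed

definition T :: "nat \<Rightarrow> real" where "T N = (\<Sum>k<N. \<sigma> k / \<sigma> 0)"
definition xbar :: "nat \<Rightarrow> 'a" where "xbar N = (1 / T N) *\<^sub>R (\<Sum>k<N. (\<sigma> k / \<sigma> 0) *\<^sub>R x (Suc k))"
definition \<Delta> :: "'a \<Rightarrow> 'b \<Rightarrow> real" where
  "\<Delta> z v = 1 / (2 * \<tau> 0) * (norm (z - x 0))\<^sup>2 + 1 / (2 * \<sigma> 0) * (norm (v - y 0))\<^sup>2"

lemma T_pos: "1 \<le> N \<Longrightarrow> 0 < T N"
  unfolding T_def by (intro sum_pos) (auto simp: \<sigma>_pos lessThan_empty_iff)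

definition weight :: "nat \<Rightarrow> nat \<Rightarrow> real" where "weight N k = \<sigma> k / \<sigma> 0 / T N"

lemma xbar_convex_combination:
  assumes "1 \<le> N"
  shows "xbar N = (\<Sum>k<N. weight N k *\<^sub>R x (Suc k))"
    and "(\<Sum>k<N. weight N k) = 1"
    and "0 \<le> weight N k"
proof -
  show "xbar N = (\<Sum>k<N. weight N k *\<^sub>R x (Suc k))"
    by (simp add: xbar_def weight_def scaleR_sum_right mult.commute)
  have "(\<Sum>k<N. weight N k) = T N / T N"
    unfolding weight_def T_def by (rule sum_divide_distrib[symmetric])
  then show "(\<Sum>k<N. weight N k) = 1"
    using T_pos[OF assms] by simp
  show "0 \<le> weight N k"
    using T_pos[OF assms] \<sigma>_pos[of k] \<sigma>_pos[of 0] by (simp add: weight_def)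
qed

lemma xbar_in_edom:
  assumes "1 \<le> N"
  shows "xbar N \<in> edom f"
  unfolding xbar_convex_combination(1)[OF assms]
  using convex_on_imp_convex[OF econvex_mod_convex_on[OF f_proper f_convex p_pos(1)]]
  by (intro convex_sum) (auto simp: xbar_convex_combination[OF assms] x_in_edom)

text \<open>Jensen's inequality for the Lagrangian at the weighted average, followed by the summed energy
  estimate; dividing the initial energy by \<open>\<sigma>\<^sub>0\<close> gives \<open>\<Delta>\<close> since \<open>\<gamma>\<^sub>0 / \<sigma>\<^sub>0 = 1 / \<tau>\<^sub>0\<close>.\<close>

lemma ergodic_lagrangian_bound:
  assumes N: "1 \<le> N" and v: "v \<in> dual_cone K"
  shows "fr (xbar N) + g (xbar N) + G (xbar N) \<bullet> v - (fr xs + g xs) \<le> 1 / T N * \<Delta> xs v"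
proof -
  let ?L = "\<lambda>z. fr z + g z + G z \<bullet> v"
  have "convex_on (edom f) ?L"
    using econvex_mod_convex_on[OF f_proper f_convex p_pos(1)]
    by (intro convex_on_add convex_on_subset[OF g_convex] convex_on_subset[OF cone_convex_inner[OF G_convex v]])
       (auto intro: convex_on_imp_convex)
  then have "?L (xbar N) \<le> (\<Sum>k<N. weight N k * ?L (x (Suc k)))"
    using N unfolding xbar_convex_combination(1)[OF N]
    by (intro convex_on_sum) (auto simp: x_in_edom xbar_convex_combination[OF N] lessThan_empty_iff)
  then have "?L (xbar N) - (fr xs + g xs) \<le> (\<Sum>k<N. weight N k * (?L (x (Suc k)) - (fr xs + g xs)))"
    using xbar_convex_combination(2)[OF N]
    by (simp add: right_diff_distrib sum_subtractf flip: sum_distrib_right)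
  also have "\<dots> \<le> (\<Sum>k<N. weight N k * gap xs v k)"
    by (intro sum_mono mult_left_mono gap_ge_lagrangian xbar_convex_combination N)
  also have "\<dots> = 1 / (T N * \<sigma> 0) * (\<Sum>k<N. \<sigma> k * gap xs v k)"
    by (simp add: weight_def sum_distrib_left field_simps)
  also have "\<dots> \<le> 1 / (T N * \<sigma> 0) * (\<gamma> 0 * breg xs (x 0) + breg v (y 0))"
    using energy_sum[OF xs_in_edom v, of N] breg_nonneg[of v "y N"] T_pos[OF N] \<sigma>_pos[of 0]
    by (intro mult_left_mono) auto
  also have "\<dots> = 1 / T N * \<Delta> xs v"
    using T_pos[OF N] \<gamma>_pos[of 0] \<tau>_pos[of 0]
    by (simp add: \<Delta>_def breg_def \<sigma>_def field_simps)
  finally show ?thesis .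
qed

definition ydag :: "real \<Rightarrow> nat \<Rightarrow> 'b" where
  "ydag \<kappa> N = (let P = closest_point (dual_cone K) (G (xbar N))
     in if P = 0 then 0 else ((norm ys + \<kappa>) / norm P) *\<^sub>R P)"

lemma norm_ydag_le: "0 < \<kappa> \<Longrightarrow> norm (ydag \<kappa> N) \<le> norm ys + \<kappa>"
  by (simp add: ydag_def Let_def)

text \<open>The multiplier \<open>ydag\<close> is the projection of \<open>G xbar\<close> onto the dual cone, rescaled to norm
  \<open>norm y\<^sup>* + \<kappa>\<close> unless it vanishes, which happens exactly when \<open>xbar\<close> is feasible. Its share \<open>norm y\<^sup>*\<close> offsets the possible superoptimality of the infeasible point
  \<open>xbar\<close>, and its share \<open>\<kappa>\<close> then measures the infeasibility. The lower bound for the objective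
  inherits the factor \<open>norm y\<^sup>* / \<kappa>\<close> from the bound for \<open>d\<close>.\<close>

lemma ergodic_rate:
  assumes \<kappa>: "0 < \<kappa>" and N: "1 \<le> N"
  defines "d \<equiv> proj_dist (uminus ` K) (G (xbar N))"
    and "r \<equiv> fr (xbar N) + g (xbar N) - (fr xs + g xs)"
    and "R \<equiv> 1 / T N * \<Delta> xs (ydag \<kappa> N)"
  shows "r \<le> R" and "\<kappa> * d \<le> R" and "- r \<le> norm ys / \<kappa> * R"
proof -
  define w P where "w = G (xbar N)" and "P = closest_point (dual_cone K) w"
  have P: "P \<in> dual_cone K"
    unfolding P_def by (intro closest_point_in_set closed_dual_cone) (use zero_in_dual_cone in blast)
  have d: "d = norm P" and wP: "w \<bullet> P = (norm P)\<^sup>2"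
    using moreau_cone_dist[OF K_cone, of w] moreau_cone_inner[OF K_cone, of w]
    by (auto simp: d_def P_def w_def)
  have "ydag \<kappa> N \<in> dual_cone K"
    using P \<kappa> by (auto simp: ydag_def Let_def P_def w_def intro!: zero_in_dual_cone dual_cone_scale)
  from ergodic_lagrangian_bound[OF N this] have "r + w \<bullet> ydag \<kappa> N \<le> R"
    by (simp add: r_def R_def w_def)
  moreover have "w \<bullet> ydag \<kappa> N = (norm ys + \<kappa>) * d"
    using wP by (simp add: ydag_def Let_def P_def[symmetric] w_def[symmetric] d power2_eq_square)
  ultimately have upper: "r + norm ys * d + \<kappa> * d \<le> R" by (simp add: distrib_right)
  have "(w - P) \<bullet> ys \<le> 0"
    using moreau_cone_residual[OF K_cone, of w] ys_dual
    by (auto simp: P_def dual_cone_def inner_commute)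
  then have "w \<bullet> ys \<le> P \<bullet> ys" by (simp add: inner_diff_left)
  also have "\<dots> \<le> norm ys * d" using norm_cauchy_schwarz[of P ys] by (simp add: d mult.commute)
  finally have lower: "- r \<le> norm ys * d"
    using lagrangian_lower_bound[OF xbar_in_edom[OF N]] by (simp add: r_def w_def)
  have d0: "0 \<le> norm ys * d" "0 \<le> \<kappa> * d" using \<kappa> by (simp_all add: d)
  show "r \<le> R" using upper d0 by linarith
  show dR: "\<kappa> * d \<le> R" using upper lower by linarith
  have "norm ys * d = norm ys / \<kappa> * (\<kappa> * d)" using \<kappa> by simp
  also have "\<dots> \<le> norm ys / \<kappa> * R" using dR \<kappa> by (intro mult_left_mono) auto
  finally show "- r \<le> norm ys / \<kappa> * R" using lower by linarith
qed

lemma \<Delta>_bounded: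
  assumes "0 < \<kappa>"
  shows "\<bar>\<Delta> xs (ydag \<kappa> N)\<bar> \<le> 1 / (2 * \<tau> 0) * (norm (xs - x 0))\<^sup>2
    + 1 / (2 * \<sigma> 0) * (norm ys + \<kappa> + norm (y 0))\<^sup>2"
proof -
  have "norm (ydag \<kappa> N - y 0) \<le> norm ys + \<kappa> + norm (y 0)"
    using norm_triangle_ineq4[of "ydag \<kappa> N" "y 0"] norm_ydag_le[OF assms, of N] by linarith
  then have "(norm (ydag \<kappa> N - y 0))\<^sup>2 \<le> (norm ys + \<kappa> + norm (y 0))\<^sup>2"
    by (rule power_mono) simp
  moreover have "0 \<le> \<Delta> xs (ydag \<kappa> N)"
    using \<tau>_pos[of 0] \<sigma>_pos[of 0] by (simp add: \<Delta>_def)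
  ultimately show ?thesis
    using \<sigma>_pos[of 0] by (simp add: \<Delta>_def divide_right_mono)
qed

end

section \<open>Step sizes\<close>

locale apdb_lipschitz = apdb_saddle +
  fixes L\<^sub>g C\<^sub>G L\<^sub>G :: real
  assumes g_Lipschitz: "L\<^sub>g-lipschitz_on UNIV (gradient g)"
    and G_Lipschitz: "C\<^sub>G-lipschitz_on UNIV G"
    and DG_Lipschitz: "0 \<le> L\<^sub>G"
      "\<And>z z' h. norm (frechet_derivative G (at z) h - frechet_derivative G (at z') h)
        \<le> L\<^sub>G * norm (z - z') * norm h"
begin

lemma linear_DG: "linear (frechet_derivative G (at z))"
  by (rule linear_frechet_derivative[OF G_diff])

lemma grad_dual_lipschitz: "norm (grad z v - grad z v') \<le> C\<^sub>G * norm (v - v')"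
proof -
  have "norm (frechet_derivative G (at z) h) \<le> C\<^sub>G * norm h" for h
    using lipschitz_derivative_bound[OF G_Lipschitz] G_diff frechet_derivative_works by blast
  from norm_adjoint_le[OF linear_DG this, of "v - v'"] show ?thesis
    by (simp add: grad_def linear_diff[OF adjoint_linear[OF linear_DG]])
qed

text \<open>The constant depends on \<open>norm v\<close>; the bound on the dual iterates makes it uniform along a run.\<close>

lemma grad_primal_lipschitz:
  "norm (grad z v - grad z' v) \<le> (L\<^sub>g + L\<^sub>G * norm v) * norm (z - z')"
proof -
  let ?D = "\<lambda>z. frechet_derivative G (at z)"
  have "adjoint (\<lambda>h. ?D z h - ?D z' h) = (\<lambda>v. adjoint (?D z) v - adjoint (?D z') v)"
    by (rule adjoint_unique)
       (simp add: inner_diff_left inner_diff_right adjoint_works[OF linear_DG])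
  moreover have "linear (\<lambda>h. ?D z h - ?D z' h)"
    by (intro linear_compose_sub linear_DG)
  ultimately have "norm (adjoint (?D z) v - adjoint (?D z') v) \<le> L\<^sub>G * norm (z - z') * norm v"
    using norm_adjoint_le[of "\<lambda>h. ?D z h - ?D z' h" "L\<^sub>G * norm (z - z')" v] DG_Lipschitz(2) by simp
  moreover have "norm (gradient g z - gradient g z') \<le> L\<^sub>g * norm (z - z')"
    using lipschitz_on_normD[OF g_Lipschitz] by simp
  ultimately show ?thesis
    using norm_triangle_ineq[of "gradient g z - gradient g z'" "adjoint (?D z) v - adjoint (?D z') v"]
    by (simp add: grad_def algebra_simps)
qed

text \<open>Each squared gradient difference in the test is at most a multiple of a Bregman distance that the
  test also contains with a negative coefficient. The ratio of the two coefficients is a constant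
  times \<open>\<gamma>\<^sub>k s\<^sup>2\<close>. The estimates hold for all pairs \<open>(x', y')\<close>, in particular for the minimisers
  computed in the inner loop.\<close>

lemma short_steps_accepted:
  obtains c where "0 < c"
    "\<And>k s x' y'. 0 < s \<Longrightarrow> \<gamma> k * s\<^sup>2 \<le> c \<Longrightarrow> apdb_accept p \<Phi> x y \<tau> \<gamma> k s x' y'"
proof -
  obtain B where B: "\<And>k. norm (y k) \<le> B" using dual_iterates_bounded by blast
  define M where "M = L\<^sub>g + L\<^sub>G * B"
  \<comment> \<open>\<open>e\<close> is the slack that \<open>\<delta>\<close> and the carried-over weights leave in the primal part of the test.\<close>
  define e where "e = 1 - p_delta p - p_calpha p - p_cbeta p"
  \<comment> \<open>The summand \<open>1\<close> in the denominators keeps them positive if a Lipschitz constant vanishes.\<close>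
  define c\<^sub>1 where "c\<^sub>1 = (1 - p_delta p) * p_calpha p / (C\<^sub>G\<^sup>2 + 1)"
  define c\<^sub>2 where "c\<^sub>2 = e * (p_gamma p * p_cbeta p) / (M\<^sup>2 + 1)"
  have "0 < e" using p_pos by (simp add: e_def)
  then have c: "0 < c\<^sub>1" "0 < c\<^sub>2"
    using p_pos by (auto simp: c\<^sub>1_def c\<^sub>2_def add_nonneg_pos)
  show thesis
  proof (rule that)
    show "0 < min c\<^sub>1 c\<^sub>2" using c by simp
    fix k s x' y' assume s: "0 < s" and le: "\<gamma> k * s\<^sup>2 \<le> min c\<^sub>1 c\<^sub>2"
    define bx b\<^sub>y where "bx = breg x' (x k)" and "b\<^sub>y = breg y' (y k)"
    have b: "0 \<le> bx" "0 \<le> b\<^sub>y" by (auto simp: bx_def b\<^sub>y_def breg_nonneg)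
    have "(norm (grad x' y' - grad x' (y k)))\<^sup>2 \<le> (C\<^sub>G * norm (y' - y k))\<^sup>2"
      by (intro power_mono grad_dual_lipschitz) auto
    then have "1 / (2 * (p_calpha p / s)) * (norm (grad x' y' - grad x' (y k)))\<^sup>2
        \<le> 1 / (2 * (p_calpha p / s)) * (2 * C\<^sub>G\<^sup>2 * b\<^sub>y)"
      using p_pos s by (intro mult_left_mono) (auto simp: b\<^sub>y_def breg_def power_mult_distrib)
    also have "\<dots> = (\<gamma> k * s\<^sup>2 * C\<^sub>G\<^sup>2 / p_calpha p) / (\<gamma> k * s) * b\<^sub>y"
      using p_pos s \<gamma>_pos[of k] by (simp add: field_simps power2_eq_square)
    also have "\<dots> \<le> (1 - p_delta p) / (\<gamma> k * s) * b\<^sub>y"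
    proof (intro mult_right_mono divide_right_mono b)
      have "\<gamma> k * s\<^sup>2 * C\<^sub>G\<^sup>2 \<le> c\<^sub>1 * (C\<^sub>G\<^sup>2 + 1)"
        using le c \<gamma>_pos[of k] by (intro mult_mono) auto
      also have "\<dots> = (1 - p_delta p) * p_calpha p"
        by (simp add: c\<^sub>1_def add_nonneg_eq_0_iff)
      finally show "\<gamma> k * s\<^sup>2 * C\<^sub>G\<^sup>2 / p_calpha p \<le> 1 - p_delta p"
        using p_pos by (simp add: divide_le_eq)
    qed (use s \<gamma>_pos[of k] in simp)
    finally have dual: "1 / (2 * (p_calpha p / s)) * (norm (grad x' y' - grad x' (y k)))\<^sup>2
        \<le> (1 - p_delta p) / (\<gamma> k * s) * b\<^sub>y" .
    have "(norm (grad x' (y k) - grad (x k) (y k)))\<^sup>2 \<le> (M * norm (x' - x k))\<^sup>2"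
    proof (intro power_mono order_trans[OF grad_primal_lipschitz] mult_right_mono)
      show "L\<^sub>g + L\<^sub>G * norm (y k) \<le> M"
        using B[of k] DG_Lipschitz(1) by (simp add: M_def mult_left_mono)
    qed auto
    then have "1 / (2 * (p_gamma p * p_cbeta p / (\<gamma> k * s))) * (norm (grad x' (y k) - grad (x k) (y k)))\<^sup>2
        \<le> 1 / (2 * (p_gamma p * p_cbeta p / (\<gamma> k * s))) * (2 * M\<^sup>2 * bx)"
      using p_pos s \<gamma>_pos[of k]
      by (intro mult_left_mono) (auto simp: bx_def breg_def power_mult_distrib)
    also have "\<dots> = (\<gamma> k * s\<^sup>2 * M\<^sup>2 / (p_gamma p * p_cbeta p)) / s * bx"
      using p_pos s \<gamma>_pos[of k] by (simp add: field_simps power2_eq_square)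
    also have "\<dots> \<le> e / s * bx"
    proof (intro mult_right_mono divide_right_mono b)
      have "\<gamma> k * s\<^sup>2 * M\<^sup>2 \<le> c\<^sub>2 * (M\<^sup>2 + 1)"
        using le c \<gamma>_pos[of k] by (intro mult_mono) auto
      also have "\<dots> = e * (p_gamma p * p_cbeta p)"
        by (simp add: c\<^sub>2_def add_nonneg_eq_0_iff)
      finally show "\<gamma> k * s\<^sup>2 * M\<^sup>2 / (p_gamma p * p_cbeta p) \<le> e"
        using p_pos by (simp add: divide_le_eq)
    qed (use s in simp)
    finally have primal: "1 / (2 * (p_gamma p * p_cbeta p / (\<gamma> k * s)))
        * (norm (grad x' (y k) - grad (x k) (y k)))\<^sup>2 \<le> e / s * bx" .
    have "\<sigma>\<^sub>p k / (\<gamma> k * s) * (\<alpha> k + \<beta> k) \<le> (p_calpha p + p_cbeta p) / s"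
      using divide_right_mono[OF previous_weight[of k], of "\<gamma> k * s"] s \<gamma>_pos[of k] by simp
    then have "\<sigma>\<^sub>p k / (\<gamma> k * s) * (\<alpha> k + \<beta> k) * bx \<le> (p_calpha p + p_cbeta p) / s * bx"
      using b by (intro mult_right_mono)
    then have momentum: "- (1 / s - \<sigma>\<^sub>p k / (\<gamma> k * s) * (\<alpha> k + \<beta> k)) * bx
        \<le> - (p_delta p / s) * bx - e / s * bx"
      by (simp add: e_def left_diff_distrib diff_divide_distrib add_divide_distrib distrib_right)
    have "apdb_E p \<Phi> x y \<tau> \<gamma> k s x' y' \<le> (1 - p_delta p) / (\<gamma> k * s) * b\<^sub>y - 1 / (\<gamma> k * s) * b\<^sub>y
        + e / s * bx + (- (p_delta p / s) * bx - e / s * bx)"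
      using dual primal momentum
      unfolding apdb_E_def Let_def gradient_\<Phi> \<alpha>_def \<beta>_def bx_def b\<^sub>y_def by linarith
    then show "apdb_accept p \<Phi> x y \<tau> \<gamma> k s x' y'"
      unfolding apdb_accept_def bx_def[symmetric] b\<^sub>y_def[symmetric]
      by (simp add: diff_divide_distrib left_diff_distrib)
  qed
qed

text \<open>Passing from an accepted step to the next trial step leaves \<open>\<gamma> \<tau>\<^sup>2\<close> unchanged. If the inner loop
  then rejects, the last rejected step satisfies \<open>\<gamma>\<^sub>k s\<^sup>2 > c\<close>, and the accepted one is \<open>\<eta> s\<close>.\<close>

lemma step_size_lower_bound:
  obtains m where "0 < m" "\<And>k. m \<le> \<gamma> k * (\<tau> k)\<^sup>2"
proof -
  obtain c where c: "0 < c"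
    "\<And>k s x' y'. 0 < s \<Longrightarrow> \<gamma> k * s\<^sup>2 \<le> c \<Longrightarrow> apdb_accept p \<Phi> x y \<tau> \<gamma> k s x' y'"
    using short_steps_accepted by blast
  define m where "m = min (p_gamma p * (p_tau p)\<^sup>2) ((p_eta p)\<^sup>2 * c)"
  have step: "m \<le> \<gamma> k * (\<tau> k)\<^sup>2" if trial: "m \<le> \<gamma> k * (tau_trial p \<tau> \<gamma> k)\<^sup>2" for k
  proof -
    obtain j where j: "\<tau> k = p_eta p ^ j * tau_trial p \<tau> \<gamma> k"
      "\<And>i. i < j \<Longrightarrow> \<exists>x' y'. \<not> apdb_accept p \<Phi> x y \<tau> \<gamma> k (p_eta p ^ i * tau_trial p \<tau> \<gamma> k) x' y'"
      using backtracking[of k] by blast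
    show ?thesis
    proof (cases j)
      case 0
      then show ?thesis using trial j by simp
    next
      case (Suc i)
      define s where "s = p_eta p ^ i * tau_trial p \<tau> \<gamma> k"
      have s: "0 < s" using tau_trial_pos p_pos by (simp add: s_def)
      have "\<not> \<gamma> k * s\<^sup>2 \<le> c" using j(2)[of i] c(2)[OF s] Suc by (auto simp: s_def)
      then have "(p_eta p)\<^sup>2 * c \<le> (p_eta p)\<^sup>2 * (\<gamma> k * s\<^sup>2)" by (intro mult_left_mono) auto
      also have "\<dots> = \<gamma> k * (\<tau> k)\<^sup>2" by (simp add: j(1) Suc s_def power_mult_distrib)
      finally show ?thesis by (simp add: m_def)
    qed
  qed
  have "m \<le> \<gamma> k * (\<tau> k)\<^sup>2" for k
  proof (induction k)
    case 0
    show ?case by (rule step) (simp add: m_def tau_trial_def prev_def \<gamma>_0)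
  next
    case (Suc k)
    have "\<gamma> (Suc k) * (tau_trial p \<tau> \<gamma> (Suc k))\<^sup>2 = \<gamma> k * (\<tau> k)\<^sup>2"
      using \<gamma>_pos[of k] \<gamma>_pos[of "Suc k"]
      by (simp add: tau_trial_def prev_def power_mult_distrib less_imp_le)
    with Suc step show ?case by simp
  qed
  moreover have "0 < m" using p_pos c(1) by (simp add: m_def)
  ultimately show thesis using that by blast
qed

lemma \<sigma>_ge_sqrt_\<gamma>:
  obtains a where "0 < a" "\<And>k. a * sqrt (\<gamma> k) \<le> \<sigma> k"
proof -
  obtain m where m: "0 < m" "\<And>k. m \<le> \<gamma> k * (\<tau> k)\<^sup>2" using step_size_lower_bound by blast
  have "sqrt m * sqrt (\<gamma> k) \<le> \<sigma> k" for k
  proof -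
    have "sqrt m * sqrt (\<gamma> k) = sqrt (\<gamma> k * m)" by (simp add: real_sqrt_mult mult.commute)
    also have "\<dots> \<le> sqrt (\<gamma> k * (\<gamma> k * (\<tau> k)\<^sup>2))"
      using m(2)[of k] \<gamma>_pos[of k] by simp
    also have "\<dots> = sqrt ((\<sigma> k)\<^sup>2)" by (simp add: \<sigma>_def power2_eq_square ac_simps)
    also have "\<dots> = \<sigma> k" using \<sigma>_pos[of k] by simp
    finally show ?thesis .
  qed
  with m(1) show thesis using that[of "sqrt m"] by simp
qed

lemma T_linear_growth: "T \<in> \<Omega>(\<lambda>N. real N)"
proof -
  obtain a where a: "0 < a" "\<And>k. a * sqrt (\<gamma> k) \<le> \<sigma> k" using \<sigma>_ge_sqrt_\<gamma> by blast
  define c where "c = a * sqrt (\<gamma> 0) / \<sigma> 0"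
  have c: "0 < c" using a(1) \<gamma>_pos[of 0] \<sigma>_pos[of 0] by (simp add: c_def)
  have "c \<le> \<sigma> k / \<sigma> 0" for k
  proof -
    have "a * sqrt (\<gamma> 0) \<le> a * sqrt (\<gamma> k)" using \<gamma>_ge_0 a(1) by simp
    with a(2)[of k] show ?thesis using \<sigma>_pos[of 0] by (simp add: c_def divide_right_mono)
  qed
  then have "(\<Sum>k<N. c) \<le> T N" for N unfolding T_def by (rule sum_mono)
  then have lower: "real N * c \<le> T N" for N by simp
  show ?thesis
  proof (rule landau_omega.bigI[OF c])
    show "eventually (\<lambda>N. c * norm (real N) \<le> norm (T N)) at_top"
      using lower c by (auto intro!: always_eventually order_trans[OF _ abs_ge_self] simp: mult.commute)
  qed
qed

text \<open>The recurrence \<open>\<gamma>\<^sub>k\<^sub>+\<^sub>1 \<ge> \<gamma>\<^sub>k + \<mu> a \<surd>\<gamma>\<^sub>k\<close> raises \<open>\<surd>\<gamma>\<^sub>k\<close> by a constant in each iteration.\<close>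

lemma sqrt_\<gamma>_linear_growth:
  assumes "0 < p_mu p"
  obtains b where "0 < b" "\<And>k. b * real (Suc k) \<le> sqrt (\<gamma> k)"
proof -
  obtain a where a: "0 < a" "\<And>k. a * sqrt (\<gamma> k) \<le> \<sigma> k" using \<sigma>_ge_sqrt_\<gamma> by blast
  \<comment> \<open>With \<open>b \<le> \<surd>\<gamma>\<^sub>k\<close> one has \<open>(\<surd>\<gamma>\<^sub>k + b)\<^sup>2 \<le> \<gamma>\<^sub>k + 3 b \<surd>\<gamma>\<^sub>k\<close>, whence the factor \<open>3\<close>.\<close>
  define b where "b = min (p_mu p * a / 3) (sqrt (\<gamma> 0))"
  have b: "0 < b" "3 * b \<le> p_mu p * a" "b \<le> sqrt (\<gamma> 0)"
    using assms a(1) \<gamma>_pos[of 0] by (auto simp: b_def min_def)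
  have step: "sqrt (\<gamma> k) + b \<le> sqrt (\<gamma> (Suc k))" for k
  proof (rule real_le_rsqrt)
    have "b \<le> sqrt (\<gamma> k)" using b(3) \<gamma>_ge_0[of k] by (meson order_trans real_sqrt_le_mono)
    then have "b * b \<le> b * sqrt (\<gamma> k)" using b(1) by simp
    moreover have "3 * b * sqrt (\<gamma> k) \<le> p_mu p * a * sqrt (\<gamma> k)"
      using b(2) \<gamma>_pos[of k] by (intro mult_right_mono) auto
    moreover have "p_mu p * (a * sqrt (\<gamma> k)) \<le> p_mu p * \<sigma> k"
      using a(2) assms by (intro mult_left_mono) auto
    moreover have "(sqrt (\<gamma> k))\<^sup>2 = \<gamma> k" using \<gamma>_pos[of k] by simp
    ultimately show "(sqrt (\<gamma> k) + b)\<^sup>2 \<le> \<gamma> (Suc k)"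
      by (simp add: \<gamma>_Suc \<sigma>_def power2_sum power2_eq_square algebra_simps)
  qed
  have "b * real (Suc k) \<le> sqrt (\<gamma> k)" for k
  proof (induction k)
    case 0
    then show ?case using b(3) by simp
  next
    case (Suc k)
    then show ?case using step[of k] by (simp add: algebra_simps)
  qed
  with b(1) show thesis using that by blast
qed

lemma T_quadratic_growth:
  assumes "0 < p_mu p"
  shows "T \<in> \<Omega>(\<lambda>N. (real N)\<^sup>2)"
proof -
  obtain a where a: "0 < a" "\<And>k. a * sqrt (\<gamma> k) \<le> \<sigma> k" using \<sigma>_ge_sqrt_\<gamma> by blast
  obtain b where b: "0 < b" "\<And>k. b * real (Suc k) \<le> sqrt (\<gamma> k)"
    using sqrt_\<gamma>_linear_growth[OF assms] by blast
  define c where "c = a * b / (2 * \<sigma> 0)"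
  have c: "0 < c" using a(1) b(1) \<sigma>_pos[of 0] by (simp add: c_def)
  have t: "2 * c * real (Suc k) \<le> \<sigma> k / \<sigma> 0" for k
  proof -
    have "a * (b * real (Suc k)) \<le> a * sqrt (\<gamma> k)" using b(2) a(1) by (intro mult_left_mono) auto
    with a(2)[of k] have "a * (b * real (Suc k)) \<le> \<sigma> k" by linarith
    from divide_right_mono[OF this, of "\<sigma> 0"] show ?thesis
      using \<sigma>_pos[of 0] by (simp add: c_def mult.assoc)
  qed
  have lower: "c * (real N)\<^sup>2 \<le> T N" for N
  proof (induction N)
    case 0
    then show ?case by (simp add: T_def)
  next
    case (Suc N)
    then show ?case using t[of N] c by (simp add: T_def power2_eq_square algebra_simps)
  qed
  show ?thesis
  proof (rule landau_omega.bigI[OF c])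
    show "eventually (\<lambda>N. c * norm ((real N)\<^sup>2) \<le> norm (T N)) at_top"
      using lower by (auto intro!: always_eventually order_trans[OF _ abs_ge_self])
  qed
qed

end

section \<open>Convergence of the modified APDB method\<close>

theorem corollary4p5:
  fixes f :: "real ^ 'n \<Rightarrow> ereal" and g :: "real ^ 'n \<Rightarrow> real" and G :: "real ^ 'n \<Rightarrow> real ^ 'm"
    and \<K> :: "(real ^ 'm) set" and L\<^sub>g C\<^sub>G L\<^sub>G :: real and p :: apdb_params
    and \<rho> :: "real ^ 'n \<Rightarrow> ereal" and \<Phi> :: "real ^ 'n \<Rightarrow> real ^ 'm \<Rightarrow> real"
    and x\<^sub>s x\<^sub>0 :: "real ^ 'n" and y\<^sub>s y\<^sub>0 :: "real ^ 'm"
    and x :: "nat \<Rightarrow> real ^ 'n" and y :: "nat \<Rightarrow> real ^ 'm" and \<tau> \<gamma> \<sigma> t T :: "nat \<Rightarrow> real"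
    and xbar :: "nat \<Rightarrow> real ^ 'n" and \<Delta> :: "real ^ 'n \<Rightarrow> real ^ 'm \<Rightarrow> real"
    and ydag :: "real \<Rightarrow> nat \<Rightarrow> real ^ 'm"
  assumes f_proper: "\<And>z. f z \<noteq> -\<infinity>" and f_closed: "closed_fun f" and f_convex: "econvex_mod (p_mu p) f"
    and g_convex: "convex_on UNIV g" and g_diff: "\<And>z. g differentiable (at z)"
    and g_Lipschitz: "L\<^sub>g-lipschitz_on UNIV (gradient g)"
    and K_cone: "\<K> \<noteq> {}" "cone \<K>" "convex \<K>" "closed \<K>"
    and G_convex: "cone_convex \<K> G" and G_diff: "\<And>z. G differentiable (at z)"
    and G_Lipschitz: "0 < C\<^sub>G" "C\<^sub>G-lipschitz_on UNIV G"
    and JG_Lipschitz: "0 \<le> L\<^sub>G"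
      "\<And>z z'. onorm ((*v) (jacobian G (at z) - jacobian G (at z'))) \<le> L\<^sub>G * norm (z - z')"
    and \<rho>: "\<And>z. \<rho> z = f z + ereal (g z)"
    and \<Phi>: "\<And>z v. \<Phi> z v = g z + G z \<bullet> v"
    and saddle: "saddle_point UNIV (dual_cone \<K>) (\<lambda>z v. \<rho> z + ereal (G z \<bullet> v)) x\<^sub>s y\<^sub>s"
    and params: "valid_params p"
    and start: "x\<^sub>0 \<in> edom f" "y\<^sub>0 \<in> dual_cone \<K>"
    and run: "apdb_run p f (ind_fun (dual_cone \<K>)) \<Phi> x\<^sub>0 y\<^sub>0 x y \<tau> \<gamma>"
    and cases: "\<K> = {w. \<forall>i. 0 \<le> w $ i} \<or> bounded ((\<lambda>z. jacobian G (at z)) ` edom f)"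
    and \<sigma>: "\<And>k. \<sigma> k = \<gamma> k * \<tau> k"
    and t: "\<And>k. t k = \<sigma> k / \<sigma> 0"
    and T: "\<And>K. T K = (\<Sum>k<K. t k)"
    and xbar: "\<And>K. xbar K = (1 / T K) *\<^sub>R (\<Sum>k<K. t k *\<^sub>R x (Suc k))"
    and \<Delta>: "\<And>z v. \<Delta> z v = 1 / (2 * \<tau> 0) * (norm (z - x\<^sub>0))\<^sup>2 + 1 / (2 * \<sigma> 0) * (norm (v - y\<^sub>0))\<^sup>2"
    and ydag: "\<And>\<kappa> K. ydag \<kappa> K =
      (let P = closest_point (dual_cone \<K>) (G (xbar K))
       in if P = 0 then 0 else ((norm y\<^sub>s + \<kappa>) / norm P) *\<^sub>R P)"
  shows "(\<forall>k. norm (y k) \<le> norm y\<^sub>s + sqrt (p_gamma p * (norm (x\<^sub>s - x\<^sub>0))\<^sup>2 + (norm (y\<^sub>s - y\<^sub>0))\<^sup>2)) \<and>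
    (\<forall>\<kappa>>0.
       (\<forall>K\<ge>1.
          max (\<rho> (xbar K) - \<rho> x\<^sub>s) (ereal (\<kappa> * proj_dist (uminus ` \<K>) (G (xbar K))))
            \<le> ereal (1 / T K * \<Delta> x\<^sub>s (ydag \<kappa> K)) \<and>
          max \<bar>\<rho> (xbar K) - \<rho> x\<^sub>s\<bar> (ereal (\<kappa> * proj_dist (uminus ` \<K>) (G (xbar K))))
            \<le> ereal (max 1 (norm y\<^sub>s / \<kappa>) * (1 / T K * \<Delta> x\<^sub>s (ydag \<kappa> K)))) \<and>
       (\<lambda>K. 1 / T K * \<Delta> x\<^sub>s (ydag \<kappa> K)) \<in> O(\<lambda>K. 1 / T K)) \<and>
    (p_mu p = 0 \<longrightarrow> T \<in> \<Omega>(\<lambda>K. real K)) \<and>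
    (p_mu p > 0 \<longrightarrow> T \<in> \<Omega>(\<lambda>K. (real K)\<^sup>2))"
proof -
  have x0: "x 0 = x\<^sub>0" and y0: "y 0 = y\<^sub>0" using run by (auto simp: apdb_run_def)
  have jacobian: "jacobian G (at z) *v h = frechet_derivative G (at z) h" for z h
    using G_diff[of z] by (simp add: jacobian_def matrix_works linear_frechet_derivative)
  interpret apdb_lipschitz f g G \<K> p \<Phi> x y \<tau> \<gamma> x\<^sub>s y\<^sub>s L\<^sub>g C\<^sub>G L\<^sub>G
  proof unfold_locales
    show "saddle_point UNIV (dual_cone \<K>) (\<lambda>z v. f z + ereal (g z) + ereal (G z \<bullet> v)) x\<^sub>s y\<^sub>s"
      using saddle unfolding \<rho> .
    show "apdb_run p f (ind_fun (dual_cone \<K>)) \<Phi> (x 0) (y 0) x y \<tau> \<gamma>"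
      using run by (simp add: x0 y0)
    show "norm (frechet_derivative G (at z) h - frechet_derivative G (at z') h)
        \<le> L\<^sub>G * norm (z - z') * norm h" for z z' h
    proof -
      have "norm ((jacobian G (at z) - jacobian G (at z')) *v h)
          \<le> onorm ((*v) (jacobian G (at z) - jacobian G (at z'))) * norm h"
        by (rule onorm) simp
      also have "\<dots> \<le> L\<^sub>G * norm (z - z') * norm h"
        by (intro mult_right_mono JG_Lipschitz) simp
      finally show ?thesis by (simp add: matrix_vector_mult_diff_rdistrib jacobian)
    qed
  qed (use f_proper f_convex g_convex g_diff g_Lipschitz K_cone G_convex G_diff G_Lipschitz(2)
      JG_Lipschitz(1) \<Phi> params start in \<open>simp_all add: x0 y0\<close>)
  have \<sigma>_eq: "local.\<sigma> = \<sigma>" by (rule ext) (simp add: local.\<sigma>_def \<sigma>)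
  have T_eq: "local.T = T" by (rule ext) (simp add: local.T_def T t \<sigma>_eq)
  have xbar_eq: "local.xbar = xbar" by (rule ext) (simp add: local.xbar_def xbar t \<sigma>_eq T_eq)
  have \<Delta>_eq: "local.\<Delta> = \<Delta>" by (intro ext) (simp add: local.\<Delta>_def \<Delta> \<sigma>_eq x0 y0)
  have ydag_eq: "local.ydag = ydag" by (intro ext) (simp add: local.ydag_def ydag xbar_eq)
  note eqs = T_eq xbar_eq \<Delta>_eq ydag_eq
  show ?thesis
  proof (intro conjI allI impI)
    fix k
    show "norm (y k) \<le> norm y\<^sub>s + sqrt (p_gamma p * (norm (x\<^sub>s - x\<^sub>0))\<^sup>2 + (norm (y\<^sub>s - y\<^sub>0))\<^sup>2)"
      using dual_iterates_bounded[of k] by (simp add: x0 y0)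
  next
    fix \<kappa> :: real and K :: nat assume \<kappa>: "0 < \<kappa>" and K: "1 \<le> K"
    define d where "d = proj_dist (uminus ` \<K>) (G (xbar K))"
    define R where "R = 1 / T K * \<Delta> x\<^sub>s (ydag \<kappa> K)"
    define r where "r = fr (xbar K) + g (xbar K) - (fr x\<^sub>s + g x\<^sub>s)"
    have rate: "r \<le> R" "\<kappa> * d \<le> R" "- r \<le> norm y\<^sub>s / \<kappa> * R"
      using ergodic_rate[OF \<kappa> K] unfolding eqs d_def R_def r_def by blast+
    have "xbar K \<in> edom f" using xbar_in_edom[OF K] unfolding eqs .
    then obtain a b where "f (xbar K) = ereal a" "f x\<^sub>s = ereal b"
      using xs_in_edom by (metis edomE)
    then have r: "\<rho> (xbar K) - \<rho> x\<^sub>s = ereal r" by (simp add: \<rho> r_def)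
    show "max (\<rho> (xbar K) - \<rho> x\<^sub>s) (ereal (\<kappa> * proj_dist (uminus ` \<K>) (G (xbar K))))
        \<le> ereal (1 / T K * \<Delta> x\<^sub>s (ydag \<kappa> K))"
      unfolding r d_def[symmetric] R_def[symmetric] using rate by simp
    have "0 \<le> \<kappa> * d" using \<kappa> by (simp add: d_def proj_dist_def)
    then have "0 \<le> R" using rate(2) by linarith
    then have "1 * R \<le> max 1 (norm y\<^sub>s / \<kappa>) * R" "norm y\<^sub>s / \<kappa> * R \<le> max 1 (norm y\<^sub>s / \<kappa>) * R"
      using mult_right_mono[OF max.cobounded1] mult_right_mono[OF max.cobounded2] by blast+
    then have "\<bar>r\<bar> \<le> max 1 (norm y\<^sub>s / \<kappa>) * R" "\<kappa> * d \<le> max 1 (norm y\<^sub>s / \<kappa>) * R"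
      using rate by linarith+
    then show "max \<bar>\<rho> (xbar K) - \<rho> x\<^sub>s\<bar> (ereal (\<kappa> * proj_dist (uminus ` \<K>) (G (xbar K))))
        \<le> ereal (max 1 (norm y\<^sub>s / \<kappa>) * (1 / T K * \<Delta> x\<^sub>s (ydag \<kappa> K)))"
      unfolding r d_def[symmetric] R_def[symmetric] by simp
  next
    fix \<kappa> :: real assume \<kappa>: "0 < \<kappa>"
    show "(\<lambda>K. 1 / T K * \<Delta> x\<^sub>s (ydag \<kappa> K)) \<in> O(\<lambda>K. 1 / T K)"
    proof (rule landau_o.bigI)
      define c where "c = 1 / (2 * \<tau> 0) * (norm (x\<^sub>s - x 0))\<^sup>2
        + 1 / (2 * \<sigma> 0) * (norm y\<^sub>s + \<kappa> + norm (y 0))\<^sup>2"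
      have c: "\<bar>\<Delta> x\<^sub>s (ydag \<kappa> K)\<bar> \<le> c" for K
        using \<Delta>_bounded[OF \<kappa>, of K] unfolding eqs \<sigma>_eq c_def .
      then have "0 \<le> c" using order_trans[OF abs_ge_zero c] by blast
      then show "0 < c + 1" by simp
      have "\<bar>1 / T K\<bar> * \<bar>\<Delta> x\<^sub>s (ydag \<kappa> K)\<bar> \<le> \<bar>1 / T K\<bar> * (c + 1)" for K
        by (rule mult_left_mono) (use c[of K] in auto)
      then show "eventually (\<lambda>K. norm (1 / T K * \<Delta> x\<^sub>s (ydag \<kappa> K)) \<le> (c + 1) * norm (1 / T K)) at_top"
        unfolding real_norm_def abs_mult by (simp add: mult.commute)
    qed
  next
    show "T \<in> \<Omega>(\<lambda>K. real K)" using T_linear_growth unfolding eqs .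
  next
    assume "p_mu p > 0"
    then show "T \<in> \<Omega>(\<lambda>K. (real K)\<^sup>2)" using T_quadratic_growth unfolding eqs by blast
  qed
qed

end
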